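(* Let $(R,m_R)$ be a Noetherian local ring of dimension $d$ and let $I_1,\dots,I_r$ be ideals of $R$. Then there exists a numerical polynomial $F\in\mathbb{Q}[n_1,\dots,n_r]$ of total degree at most $d$ such that $$l_R\left(H^0_{m_R}\left(\frac{R}{I_1^{n_1}\cdots I_r^{n_r}}\right)\right)\le F(n_1,\dots,n_r)$$ for all $n_1,\dots,n_r\gg0$.
   Context: $H^0_{m_R}(N)$ is the submodule of elements of $N$ annihilated by some power of $m_R$; $l_R$ denotes length. A numerical polynomial is a polynomial with rational coefficients taking integer values at integer points. *)

theory Defs
  imports "HOL-Algebra.Algebra" "HOL-Library.Extended_Nat"
begin

fun ideal_pow :: "('a, 'b) ring_scheme \<Rightarrow> 'a set \<Rightarrow> nat \<Rightarrow> 'a set" where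
  "ideal_pow R J 0 = carrier R"
| "ideal_pow R J (Suc k) = ideal_prod R (ideal_pow R J k) J"

fun ideal_multi_pow :: "('a, 'b) ring_scheme \<Rightarrow> (nat \<Rightarrow> 'a set) \<Rightarrow> (nat \<Rightarrow> nat) \<Rightarrow> nat \<Rightarrow> 'a set" where
  "ideal_multi_pow R I n 0 = carrier R"
| "ideal_multi_pow R I n (Suc k) = ideal_prod R (ideal_multi_pow R I n k) (ideal_pow R (I k) (n k))"

definition local_ring :: "('a, 'b) ring_scheme \<Rightarrow> bool" where
  "local_ring R \<longleftrightarrow> cring R \<and> (\<exists>!m. maximalideal m R)"

definition max_ideal :: "('a, 'b) ring_scheme \<Rightarrow> 'a set" where
  "max_ideal R = (THE m. maximalideal m R)"

definition krull_dim :: "('a, 'b) ring_scheme \<Rightarrow> enat" where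
  "krull_dim R = Sup {enat n | n. \<exists>P. (\<forall>i\<le>n. primeideal (P i) R) \<and> (\<forall>i<n. P i \<subset> P (Suc i))}"

definition module_length :: "('a, 'c) ring_scheme \<Rightarrow> ('a, 'b) module \<Rightarrow> enat" where
  "module_length R M = Sup {enat n | n. \<exists>c. (\<forall>i\<le>n. submodule (c i) R M) \<and> (\<forall>i<n. c i \<subset> c (Suc i))}"

definition quot_module :: "('a, 'c) ring_scheme \<Rightarrow> 'a set \<Rightarrow> ('a, 'a set) module" where
  "quot_module R J =
    \<lparr>partial_object.carrier = a_rcosets\<^bsub>R\<^esub> J, monoid.mult = rcoset_mult R J, monoid.one = (J +>\<^bsub>R\<^esub> \<one>\<^bsub>R\<^esub>),
     ring.zero = J, ring.add = set_add R, module.smult = (%a. rcoset_mult R J (a_r_coset R J a))\<rparr>"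

definition H0_set :: "('a, 'c) ring_scheme \<Rightarrow> 'a set \<Rightarrow> 'a set \<Rightarrow> 'a set set" where
  "H0_set R m J = {Y. Y \<in> carrier (quot_module R J) \<and> (\<exists>k. \<forall>a \<in> ideal_pow R m k.
        module.smult (quot_module R J) a Y = ring.zero (quot_module R J))}"

definition H0_quot :: "('a, 'c) ring_scheme \<Rightarrow> 'a set \<Rightarrow> 'a set \<Rightarrow> ('a, 'a set) module" where
  "H0_quot R m J = partial_object.carrier_update (\<lambda>_. H0_set R m J) (quot_module R J)"

definition exps :: "nat \<Rightarrow> nat \<Rightarrow> (nat \<Rightarrow> nat) set" where
  "exps r d = {e. (\<forall>i\<ge>r. e i = 0) \<and> (\<Sum>i<r. e i) \<le> d}"

definition mpoly_fun :: "nat \<Rightarrow> nat \<Rightarrow> ((nat \<Rightarrow> nat) \<Rightarrow> rat) \<Rightarrow> (nat \<Rightarrow> int) \<Rightarrow> rat" where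
  "mpoly_fun r d c x = (\<Sum>e\<in>exps r d. c e * (\<Prod>i<r. of_int (x i) ^ e i))"

definition numerical_poly :: "nat \<Rightarrow> nat \<Rightarrow> ((nat \<Rightarrow> int) \<Rightarrow> rat) \<Rightarrow> bool" where
  "numerical_poly r d F \<longleftrightarrow> (\<exists>c. F = mpoly_fun r d c) \<and> (\<forall>x. F x \<in> \<int>)"

end

theory Submission
  imports Defs Complex_Main "HOL-Library.Function_Algebras" "HOL-Library.Fun_Lexorder"
begin

text \<open>
  Write \<open>m\<close> for the maximal ideal and \<open>I\<^sup>n\<close> for \<open>I\<^sub>1\<^bsup>n\<^sub>1\<^esup> \<cdots> I\<^sub>r\<^bsup>n\<^sub>r\<^esup>\<close>. A graded Hilbert basis argument for the
  Rees algebra of \<open>I\<^sub>1, \<dots>, I\<^sub>r, m\<close> yields a constant \<open>c\<close> with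
  \<open>m\<^sup>k I\<^sup>a \<inter> (I\<^bsup>a+e\<^esup> : m\<^sup>\<infinity>) \<subseteq> m\<^bsup>k-c\<^esup> I\<^bsup>a+e\<^esup>\<close> for all \<open>a\<close>, all unit vectors \<open>e\<close> and all \<open>k \<ge> c\<close>. Following
  a path from \<open>0\<close> to \<open>n\<close> gives \<open>(I\<^sup>n : m\<^sup>\<infinity>) \<inter> m\<^bsup>c|n|\<^esup> \<subseteq> I\<^sup>n\<close>. Hence the module in question, which is
  \<open>(I\<^sup>n : m\<^sup>\<infinity>) / I\<^sup>n\<close>, embeds into \<open>R / Q\<close> for every ideal \<open>Q \<subseteq> m\<^bsup>c|n|\<^esup>\<close>. If \<open>Q\<close> is generated by the
  \<open>k\<close>-th powers of a system of \<open>d\<close> parameters \<open>x\<^sub>1, \<dots>, x\<^sub>d\<close>, where \<open>k = c|n| + 1\<close>, the length of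
  \<open>R / Q\<close> is at most \<open>k\<^sup>d\<close> times that of \<open>R / (x\<^sub>1, \<dots>, x\<^sub>d)\<close>.
\<close>

text \<open>The usual Artin-Rees lemma, applied for each \<open>n\<close> separately, gives a
  constant depending on \<open>n\<close> in an uncontrolled way, whereas a bound of degree
  \<open>d\<close> leaves room only for linear growth in |n|. Therefore all exponents are treated at
  once: the components J^b \<inter> (J^(b+e) : m^\<infinity>) form one graded ideal. It is generated
  in finitely many degrees f, and for each f a fixed power of m carries the component into J^(f+e).
  The constant \<open>c\<close> bounds these powers together with the m-degrees of the f, so it is
  the number of powers of m lost per unit step, whatever the starting point. A path of |n| steps
  loses c|n| of them, which makes \<open>k\<close> affine in \<open>n\<close>, and the degree
  \<open>d\<close> then comes only from the factor k^d in the colength of \<open>Q\<close>.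

  The products of ideals are handled through monomials in chosen generators. These monomials may be
  linearly dependent, so leading coefficients belong to expressions and not to elements; this shapes
  the graded Hilbert basis argument.

  Lengths are measured throughout by chains of ideals of \<open>R\<close>; the quotient module
  enters only at the end.\<close>

no_notation Sum_Type.Plus (infixr \<open><+>\<close> 65)

section \<open>Length of chains of ideals\<close>

context cring
begin

lemma ideal_add_closed: "ideal A R \<Longrightarrow> x \<in> A \<Longrightarrow> y \<in> A \<Longrightarrow> x \<oplus> y \<in> A"
  by (simp add: additive_subgroup.a_closed ideal.axioms(1))

lemma ideal_minus_closed: "ideal A R \<Longrightarrow> x \<in> A \<Longrightarrow> y \<in> A \<Longrightarrow> x \<ominus> y \<in> A"
  by (simp add: a_minus_def additive_subgroup.a_closed additive_subgroup.a_inv_closed ideal.axioms(1))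

lemma ideal_zero_closed: "ideal A R \<Longrightarrow> \<zero> \<in> A"
  by (simp add: additive_subgroup.zero_closed ideal.axioms(1))

lemma ideal_subset_carrier: "ideal A R \<Longrightarrow> A \<subseteq> carrier R"
  by (meson ideal.Icarr subsetI)

lemma ideal_add_cancel:
  assumes "ideal A R" "x \<oplus> y \<in> A" "x \<in> A" "y \<in> carrier R"
  shows "y \<in> A"
proof -
  have "(x \<oplus> y) \<ominus> x = y"
    using assms ideal.Icarr[OF assms(1,3)] by algebra
  then show ?thesis
    using ideal_minus_closed[OF assms(1-3)] by simp
qed

lemma sum_ideals_iff: "x \<in> A <+> B \<longleftrightarrow> (\<exists>a\<in>A. \<exists>b\<in>B. x = a \<oplus> b)"
  by (auto simp: set_add_def')

lemma subset_sum_ideals: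
  assumes "ideal A R" "ideal B R"
  shows "A \<subseteq> A <+> B" "B \<subseteq> A <+> B"
proof -
  show "A \<subseteq> A <+> B"
    unfolding sum_ideals_iff subset_iff
    by (metis assms ideal.Icarr ideal_zero_closed r_zero)
  show "B \<subseteq> A <+> B"
    unfolding sum_ideals_iff subset_iff
    by (metis assms ideal.Icarr ideal_zero_closed l_zero)
qed

lemma sum_ideals_minimal:
  assumes "ideal C R" "A \<subseteq> C" "B \<subseteq> C"
  shows "A <+> B \<subseteq> C"
  using assms(2,3) ideal_add_closed[OF assms(1)] by (fastforce simp: sum_ideals_iff)

lemma genideal_insertE:
  assumes "insert y B \<subseteq> carrier R" "x \<in> Idl (insert y B)"
  obtains c b where "c \<in> carrier R" "b \<in> Idl B" "x = c \<otimes> y \<oplus> b"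
proof -
  have y: "y \<in> carrier R" and B: "B \<subseteq> carrier R" using assms(1) by auto
  have id: "ideal (PIdl y <+> Idl B) R"
    by (intro add_ideals cgenideal_ideal genideal_ideal y B)
  have "insert y B \<subseteq> PIdl y <+> Idl B"
    using subset_sum_ideals[OF cgenideal_ideal[OF y] genideal_ideal[OF B]]
      cgenideal_self[OF y] genideal_self[OF B] by auto
  then have "x \<in> PIdl y <+> Idl B"
    using genideal_minimal[OF id] assms(2) by blast
  then show thesis
    unfolding sum_ideals_iff cgenideal_def using that by auto
qed

text \<open>This is the colon ideal \<open>D : g\<close>. It turns a statement about products lying
  in \<open>D\<close> into one about a single factor, which can then be checked on generators by
  \<open>genideal_minimal\<close>.\<close>

lemma preimage_mult_ideal:
  assumes "ideal D R" "g \<in> carrier R"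
  shows "ideal {a \<in> carrier R. a \<otimes> g \<in> D} R"
proof (rule idealI)
  show "ring R" by (rule ring_axioms)
  show "subgroup {a \<in> carrier R. a \<otimes> g \<in> D} (add_monoid R)"
  proof (rule add.subgroupI)
    show "{a \<in> carrier R. a \<otimes> g \<in> D} \<noteq> {}"
      using ideal_zero_closed[OF assms(1)] assms(2) by (auto intro!: exI[of _ \<zero>])
  next
    fix a assume a: "a \<in> {a \<in> carrier R. a \<otimes> g \<in> D}"
    have "\<zero> \<ominus> (a \<otimes> g) \<in> D"
      using ideal_minus_closed ideal_zero_closed assms(1) a by blast
    moreover have "\<zero> \<ominus> (a \<otimes> g) = (\<ominus> a) \<otimes> g"
      using a assms(2) by (simp add: a_minus_def l_minus)
    ultimately show "\<ominus> a \<in> {a \<in> carrier R. a \<otimes> g \<in> D}"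
      using a by auto
  qed (use assms ideal_add_closed in \<open>auto simp: l_distr\<close>)
next
  fix a x assume a: "a \<in> {a \<in> carrier R. a \<otimes> g \<in> D}" and x: "x \<in> carrier R"
  have *: "x \<otimes> a \<otimes> g = x \<otimes> (a \<otimes> g)" "a \<otimes> x \<otimes> g = x \<otimes> (a \<otimes> g)"
    using a x assms(2) by (auto simp: m_assoc m_lcomm m_comm)
  then have "x \<otimes> a \<otimes> g \<in> D" "a \<otimes> x \<otimes> g \<in> D"
    using ideal.I_l_closed[OF assms(1)] a x by auto
  then show "x \<otimes> a \<in> {a \<in> carrier R. a \<otimes> g \<in> D}" "a \<otimes> x \<in> {a \<in> carrier R. a \<otimes> g \<in> D}"
    using a x by auto
qed

text \<open>Counting the strict steps of weakly ascending chains makes the bounds additive without having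
  to extract strictly ascending subchains.\<close>

definition length_le :: "'a set \<Rightarrow> 'a set \<Rightarrow> nat \<Rightarrow> bool" where
  "length_le A B N \<longleftrightarrow>
    (\<forall>n C. (\<forall>i\<le>n. ideal (C i) R \<and> A \<subseteq> C i \<and> C i \<subseteq> B) \<and> (\<forall>i<n. C i \<subseteq> C (Suc i))
       \<longrightarrow> card {i. i < n \<and> C i \<noteq> C (Suc i)} \<le> N)"

lemma length_leI:
  assumes "\<And>n C. (\<And>i. i \<le> n \<Longrightarrow> ideal (C i) R) \<Longrightarrow> (\<And>i. i \<le> n \<Longrightarrow> A \<subseteq> C i) \<Longrightarrow>
    (\<And>i. i \<le> n \<Longrightarrow> C i \<subseteq> B) \<Longrightarrow> (\<And>i. i < n \<Longrightarrow> C i \<subseteq> C (Suc i)) \<Longrightarrow>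
    card {i. i < n \<and> C i \<noteq> C (Suc i)} \<le> N"
  shows "length_le A B N"
  using assms unfolding length_le_def by simp

lemma length_leD:
  assumes "length_le A B N" "\<And>i. i \<le> n \<Longrightarrow> ideal (C i) R" "\<And>i. i \<le> n \<Longrightarrow> A \<subseteq> C i"
    "\<And>i. i \<le> n \<Longrightarrow> C i \<subseteq> B" "\<And>i. i < n \<Longrightarrow> C i \<subseteq> C (Suc i)"
  shows "card {i. i < n \<and> C i \<noteq> C (Suc i)} \<le> N"
  using assms unfolding length_le_def by simp

lemma length_le_mono:
  assumes "length_le A B N" "A \<subseteq> A'" "B' \<subseteq> B"
  shows "length_le A' B' N"
proof (rule length_leI)
  fix n :: nat and C assume C: "\<And>i. i \<le> n \<Longrightarrow> ideal (C i) R" "\<And>i. i \<le> n \<Longrightarrow> A' \<subseteq> C i"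
    "\<And>i. i \<le> n \<Longrightarrow> C i \<subseteq> B'" "\<And>i. i < n \<Longrightarrow> C i \<subseteq> C (Suc i)"
  show "card {i. i < n \<and> C i \<noteq> C (Suc i)} \<le> N"
    by (rule length_leD[OF assms(1)]) (use C assms in blast)+
qed

lemma length_le_weaken: "length_le A B N \<Longrightarrow> N \<le> N' \<Longrightarrow> length_le A B N'"
  unfolding length_le_def by (meson order_trans)

lemma length_le_refl: "length_le A A 0"
proof (rule length_leI)
  fix n :: nat and C assume "\<And>i. i \<le> n \<Longrightarrow> A \<subseteq> C i" "\<And>i. i \<le> n \<Longrightarrow> C i \<subseteq> A"
  then have "C i = A" if "i \<le> n" for i
    using that by blast
  then have "{i. i < n \<and> C i \<noteq> C (Suc i)} = {}"
    by auto
  then show "card {i. i < n \<and> C i \<noteq> C (Suc i)} \<le> 0"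
    by simp
qed

text \<open>Write \<open>y \<in> D\<close> as \<open>c \<oplus> b\<close> with
  \<open>c \<in> C\<close> and \<open>b \<in> B\<close>. Then \<open>b\<close> is a difference of
  elements of \<open>D\<close>, so it lies in \<open>D \<inter> B = C \<inter> B\<close>, and
  \<open>y\<close> lies in \<open>C\<close>.\<close>

lemma modular_eq:
  assumes "ideal B R" "ideal C R" "ideal D R" "C \<subseteq> D"
    "C \<inter> B = D \<inter> B" "C <+> B = D <+> B"
  shows "C = D"
proof
  show "D \<subseteq> C"
  proof
    fix y assume y: "y \<in> D"
    then have "y \<in> C <+> B"
      using subset_sum_ideals(1)[OF assms(3,1)] assms(6) by auto
    then obtain c b where cb: "c \<in> C" "b \<in> B" "y = c \<oplus> b"
      unfolding sum_ideals_iff by blast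
    have "b \<in> D"
      using ideal_add_cancel[OF assms(3), of c b] y assms(4) cb ideal.Icarr[OF assms(1)] by auto
    then have "b \<in> C"
      using cb assms(5) by blast
    then show "y \<in> C"
      using cb ideal_add_closed[OF assms(2)] by simp
  qed
qed (rule assms)

text \<open>By the modular law, a strict inclusion \<open>C \<subset> D\<close> stays strict after intersecting with \<open>B\<close> or
  after adding \<open>B\<close>.\<close>

lemma length_le_trans:
  assumes "ideal B R" "A \<subseteq> B" "B \<subseteq> E" "ideal E R" "length_le A B N" "length_le B E M"
  shows "length_le A E (N + M)"
proof (rule length_leI)
  fix n :: nat and C assume C: "\<And>i. i \<le> n \<Longrightarrow> ideal (C i) R" "\<And>i. i \<le> n \<Longrightarrow> A \<subseteq> C i"
    "\<And>i. i \<le> n \<Longrightarrow> C i \<subseteq> E" "\<And>i. i < n \<Longrightarrow> C i \<subseteq> C (Suc i)"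
  let ?S = "{i. i < n \<and> C i \<inter> B \<noteq> C (Suc i) \<inter> B}"
  let ?T = "{i. i < n \<and> C i <+> B \<noteq> C (Suc i) <+> B}"
  have "card ?S \<le> N"
  proof (rule length_leD[OF assms(5)])
    fix i assume i: "i \<le> n"
    show "ideal (C i \<inter> B) R"
      by (intro i_intersect C i assms)
    show "A \<subseteq> C i \<inter> B"
      using C(2)[OF i] assms(2) by blast
  next
    fix i assume i: "i < n"
    show "C i \<inter> B \<subseteq> C (Suc i) \<inter> B"
      using C(4)[OF i] by blast
  qed blast
  moreover have "card ?T \<le> M"
  proof (rule length_leD[OF assms(6)])
    fix i assume i: "i < n"
    show "C i <+> B \<subseteq> C (Suc i) <+> B"
      using C(4)[OF i] unfolding subset_iff sum_ideals_iff by blast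
  next
    fix i assume i: "i \<le> n"
    show "C i <+> B \<subseteq> E"
      by (intro sum_ideals_minimal assms C i)
    show "ideal (C i <+> B) R"
      by (intro add_ideals assms C i)
    show "B \<subseteq> C i <+> B"
      by (intro subset_sum_ideals assms C i)
  qed
  moreover have "{i. i < n \<and> C i \<noteq> C (Suc i)} \<subseteq> ?S \<union> ?T"
  proof
    fix i assume "i \<in> {i. i < n \<and> C i \<noteq> C (Suc i)}"
    then show "i \<in> ?S \<union> ?T"
      using modular_eq[OF assms(1) C(1)[of i] C(1)[of "Suc i"] C(4)[of i]] by auto
  qed
  then have "card {i. i < n \<and> C i \<noteq> C (Suc i)} \<le> card ?S + card ?T"
    by (intro order_trans[OF card_mono card_Un_le]) auto
  ultimately show "card {i. i < n \<and> C i \<noteq> C (Suc i)} \<le> N + M"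
    by linarith
qed

text \<open>Multiplication by \<open>g\<close> maps R/Q onto (Rg + A)/A, which contains B/A. A chain
  is pulled back by taking colon ideals \<open>C i : g\<close>. No strict step is lost: an element
  \<open>c \<otimes> g \<oplus> a\<close> of \<open>C (Suc i)\<close> has
  \<open>c \<in> D (Suc i)\<close>, and it already lies in \<open>C i\<close> once
  \<open>c \<in> D i\<close>.\<close>

lemma length_le_cyclic:
  assumes "ideal A R" "g \<in> carrier R" "\<And>a. a \<in> Q \<Longrightarrow> a \<otimes> g \<in> A" "Q \<subseteq> carrier R"
    "\<And>x. x \<in> B \<Longrightarrow> \<exists>c\<in>carrier R. \<exists>a\<in>A. x = c \<otimes> g \<oplus> a"
    "length_le Q (carrier R) N"
  shows "length_le A B N"
proof (rule length_leI)
  fix n :: nat and C assume C: "\<And>i. i \<le> n \<Longrightarrow> ideal (C i) R" "\<And>i. i \<le> n \<Longrightarrow> A \<subseteq> C i"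
    "\<And>i. i \<le> n \<Longrightarrow> C i \<subseteq> B" "\<And>i. i < n \<Longrightarrow> C i \<subseteq> C (Suc i)"
  define D where "D i = {a \<in> carrier R. a \<otimes> g \<in> C i}" for i
  have "card {i. i < n \<and> D i \<noteq> D (Suc i)} \<le> N"
  proof (rule length_leD[OF assms(6)])
    fix i assume "i \<le> n"
    then show "ideal (D i) R"
      unfolding D_def by (intro preimage_mult_ideal C assms)
    show "Q \<subseteq> D i"
      using assms(3,4) C(2)[OF \<open>i \<le> n\<close>] unfolding D_def by blast
  next
    fix i assume "i < n"
    then show "D i \<subseteq> D (Suc i)"
      using C(4) unfolding D_def by blast
  qed (auto simp: D_def)
  moreover have "C i = C (Suc i)" if "i < n" "D i = D (Suc i)" for i
  proof
    show "C (Suc i) \<subseteq> C i"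
    proof
      fix y assume y: "y \<in> C (Suc i)"
      then obtain c a where ca: "c \<in> carrier R" "a \<in> A" "y = c \<otimes> g \<oplus> a"
        using assms(5) C(3)[of "Suc i"] \<open>i < n\<close> by (metis Suc_leI subsetD)
      have "a \<in> C (Suc i)" using C(2)[of "Suc i"] ca that by auto
      then have "a \<oplus> c \<otimes> g \<in> C (Suc i)"
        using y ca assms(2) ideal.Icarr[OF assms(1)] by (simp add: a_comm)
      then have "c \<otimes> g \<in> C (Suc i)"
        using ideal_add_cancel[OF C(1)[of "Suc i"], of a] ca that assms(2) \<open>a \<in> C (Suc i)\<close> by auto
      then have "c \<otimes> g \<in> C i"
        using that(2) ca(1) unfolding D_def by auto
      then show "y \<in> C i"
        using ca C(1,2)[of i] that ideal_add_closed by auto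
    qed
  qed (use C that in auto)
  then have "{i. i < n \<and> C i \<noteq> C (Suc i)} \<subseteq> {i. i < n \<and> D i \<noteq> D (Suc i)}"
    by blast
  then have "card {i. i < n \<and> C i \<noteq> C (Suc i)} \<le> card {i. i < n \<and> D i \<noteq> D (Suc i)}"
    by (intro card_mono) auto
  ultimately show "card {i. i < n \<and> C i \<noteq> C (Suc i)} \<le> N"
    by linarith
qed

text \<open>The ideals generated by \<open>B\<close> and the successive powers of \<open>y\<close>
  form a filtration. Each of its quotients is generated by the class of \<open>y [^] k\<close> and
  annihilated by \<open>y\<close> and \<open>B\<close>, so it contributes at most
  \<open>N\<close>.\<close>

lemma length_le_power_generator:
  assumes "B \<subseteq> carrier R" "y \<in> carrier R" "length_le (Idl (insert y B)) (carrier R) N"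
  shows "length_le (Idl (insert (y [^] k) B)) (carrier R) (k * N)"
proof (induction k)
  case 0
  have carr: "insert \<one> B \<subseteq> carrier R" using assms(1) by auto
  have "Idl (insert \<one> B) = carrier R"
    using genideal_self[OF carr] by (intro ideal.one_imp_carrier genideal_ideal[OF carr]) auto
  then show ?case
    using length_le_refl by simp
next
  case (Suc k)
  let ?A = "\<lambda>k. Idl (insert (y [^] (k::nat)) B)"
  have carr: "insert (y [^] k) B \<subseteq> carrier R" for k :: nat
    using assms by auto
  have id: "ideal (?A k) R" for k
    using carr by (rule genideal_ideal)
  have mem: "y [^] k \<in> ?A k" "B \<subseteq> ?A k" for k
    using genideal_self[OF carr] by auto
  have Bid: "ideal (Idl B) R" and BA: "Idl B \<subseteq> ?A k" for k
    using assms(1) genideal_ideal genideal_minimal[OF id mem(2)] by auto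
  have "length_le (?A (Suc k)) (?A k) N"
  proof (rule length_le_cyclic[OF id _ _ _ _ assms(3)])
    show "y [^] k \<in> carrier R" using assms by simp
    have c': "insert y B \<subseteq> carrier R" using assms by auto
    show "Idl (insert y B) \<subseteq> carrier R"
      using ideal_subset_carrier genideal_ideal[OF c'] by auto
    fix a assume "a \<in> Idl (insert y B)"
    then obtain c b where cb: "c \<in> carrier R" "b \<in> Idl B" "a = c \<otimes> y \<oplus> b"
      using genideal_insertE[OF c'] by blast
    have b: "b \<in> carrier R" using cb ideal.Icarr[OF Bid] by auto
    have "a \<otimes> y [^] k = c \<otimes> y [^] (Suc k) \<oplus> b \<otimes> y [^] k"
      using cb b assms(2) by (simp add: l_distr m_assoc) (simp add: m_comm)
    moreover have "c \<otimes> y [^] (Suc k) \<in> ?A (Suc k)"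
      by (rule ideal.I_l_closed[OF id mem(1) cb(1)])
    moreover have "b \<otimes> y [^] k \<in> ?A (Suc k)"
      using ideal.I_r_closed[OF id _ nat_pow_closed[OF assms(2)]] subsetD[OF BA cb(2)] by blast
    ultimately show "a \<otimes> y [^] k \<in> ?A (Suc k)"
      using ideal_add_closed[OF id] by presburger
  next
    fix x assume "x \<in> ?A k"
    then obtain c b where cb: "c \<in> carrier R" "b \<in> Idl B" "x = c \<otimes> y [^] k \<oplus> b"
      using genideal_insertE[OF carr] by blast
    then show "\<exists>c\<in>carrier R. \<exists>a\<in>?A (Suc k). x = c \<otimes> y [^] k \<oplus> a"
      using BA by blast
  qed
  moreover have "?A (Suc k) \<subseteq> ?A k"
  proof (rule genideal_minimal[OF id])
    have "y [^] Suc k \<in> ?A k"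
      using ideal.I_r_closed[OF id mem(1)] assms by auto
    then show "insert (y [^] Suc k) B \<subseteq> ?A k" using mem by auto
  qed
  ultimately have "length_le (?A (Suc k)) (carrier R) (N + k * N)"
    using length_le_trans[OF id] Suc oneideal ideal_subset_carrier[OF id] by blast
  then show ?case by simp
qed

text \<open>The generators are raised to the power one at a time. Those not being treated are stored
  in \<open>B\<close>, which therefore has to vary in the induction.\<close>

lemma length_le_power_generators:
  assumes "finite Y" "Y \<subseteq> carrier R" "B \<subseteq> carrier R" "length_le (Idl (Y \<union> B)) (carrier R) N"
  shows "length_le (Idl ((\<lambda>x. x [^] k) ` Y \<union> B)) (carrier R) (k ^ card Y * N)"
  using assms
proof (induction Y arbitrary: B rule: finite_induct)
  case empty
  then show ?case by simp
next
  case (insert x Y)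
  let ?P = "\<lambda>x. x [^] (k::nat)"
  have "length_le (Idl (?P ` Y \<union> insert x B)) (carrier R) (k ^ card Y * N)"
    using insert by (intro insert.IH) auto
  then have "length_le (Idl (insert x (?P ` Y \<union> B))) (carrier R) (k ^ card Y * N)"
    by simp
  then have "length_le (Idl (insert (x [^] k) (?P ` Y \<union> B))) (carrier R) (k * (k ^ card Y * N))"
    using insert by (intro length_le_power_generator) auto
  then show ?case
    using insert by (simp add: mult.assoc)
qed

text \<open>A chain above \<open>M\<close> takes only the two values \<open>M\<close> and
  \<open>carrier R\<close>, so it jumps at most once.\<close>

lemma length_le_maximal:
  assumes "maximalideal M R"
  shows "length_le M (carrier R) 1"
proof (rule length_leI)
  fix n :: nat and C assume C: "\<And>i. i \<le> n \<Longrightarrow> ideal (C i) R" "\<And>i. i \<le> n \<Longrightarrow> M \<subseteq> C i"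
    "\<And>i. i \<le> n \<Longrightarrow> C i \<subseteq> carrier R" "\<And>i. i < n \<Longrightarrow> C i \<subseteq> C (Suc i)"
  have or: "C i = M \<or> C i = carrier R" if "i \<le> n" for i
    using maximalideal.I_maximal[OF assms C(1)[OF that] C(2)[OF that] C(3)[OF that]] .
  have mono: "C i \<subseteq> C j" if "i \<le> j" "j \<le> n" for i j
    using that
  proof (induction rule: dec_induct)
    case (step k)
    then show ?case using C(4)[of k] by auto
  qed simp
  have ne: "M \<noteq> carrier R" using maximalideal.I_notcarr[OF assms] by simp
  have "i = j" if "i < n" "C i \<noteq> C (Suc i)" "j < n" "C j \<noteq> C (Suc j)" for i j
  proof -
    have *: "\<not> a < b" if "a < n" "C a \<noteq> C (Suc a)" "b < n" "C b \<noteq> C (Suc b)" for a b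
    proof
      assume "a < b"
      have "C (Suc a) = carrier R" "C b = M"
        using or[of a] or[of "Suc a"] or[of b] or[of "Suc b"] C(2)[of "Suc a"] C(4)[of a] C(4)[of b]
          C(2)[of b] C(3)[of "Suc a"] C(3)[of "Suc b"] that by auto
      then show False
        using mono[of "Suc a" b] \<open>a < b\<close> that C(2)[of b] ne C(1)[of b] ideal_subset_carrier[of M]
          assms maximalideal.axioms(1)
        by (metis Suc_leI less_imp_le subset_antisym)
    qed
    then show ?thesis using that by (meson linorder_neqE_nat)
  qed
  then show "card {i. i < n \<and> C i \<noteq> C (Suc i)} \<le> 1"
    by (subst One_nat_def, subst card_le_Suc0_iff_eq) auto
qed

end

section \<open>Systems of parameters\<close>

lemma strict_chain_extend:
  fixes c :: "nat \<Rightarrow> 'a set"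
  assumes "\<forall>j\<le>i. P (c j)" "\<forall>j<i. c j \<subset> c (Suc j)" "c i \<subset> Q" "P Q"
  shows "\<exists>c'. (\<forall>j\<le>Suc i. P (c' j)) \<and> (\<forall>j<Suc i. c' j \<subset> c' (Suc j)) \<and> c' (Suc i) = Q"
proof (intro exI conjI allI impI)
  let ?c = "c(Suc i := Q)"
  show "P (?c j)" if "j \<le> Suc i" for j
    using assms(1,4) that by (cases "j = Suc i") auto
  show "?c j \<subset> ?c (Suc j)" if "j < Suc i" for j
    using assms(2,3) that by (cases "j = i") (simp_all only: fun_upd_apply, simp_all)
  show "?c (Suc i) = Q" by simp
qed

section \<open>Products and powers of ideals, prime avoidance\<close>

context cring
begin

lemma ideal_prod_least:
  assumes "ideal C R" "\<And>a b. a \<in> A \<Longrightarrow> b \<in> B \<Longrightarrow> a \<otimes> b \<in> C"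
  shows "A \<cdot> B \<subseteq> C"
proof
  fix x assume "x \<in> A \<cdot> B"
  then show "x \<in> C"
    by (induction rule: ideal_prod.induct) (simp_all add: assms(2) ideal_add_closed[OF assms(1)])
qed

lemma ideal_prod_mono:
  assumes "A \<subseteq> A'" "B \<subseteq> B'"
  shows "A \<cdot> B \<subseteq> A' \<cdot> B'"
proof
  fix x assume "x \<in> A \<cdot> B"
  then show "x \<in> A' \<cdot> B'"
    by (induction rule: ideal_prod.induct) (use assms in \<open>auto intro: ideal_prod.intros\<close>)
qed

lemma ideal_pow_ideal: "ideal J R \<Longrightarrow> ideal (ideal_pow R J k) R"
  by (induction k) (auto intro: ideal_prod_is_ideal oneideal)

lemma ideal_pow_add:
  assumes "ideal J R"
  shows "ideal_pow R J (a + b) = ideal_pow R J a \<cdot> ideal_pow R J b"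
  by (induction b) (simp_all add: ideal_prod_one ideal_prod_assoc ideal_pow_ideal assms)

lemma ideal_pow_antimono:
  assumes "ideal J R" "a \<le> b"
  shows "ideal_pow R J b \<subseteq> ideal_pow R J a"
  using ideal_pow_add[OF assms(1), of a "b - a"] assms
    ideal_prod_inter[OF ideal_pow_ideal ideal_pow_ideal, of J J a "b - a"]
  by auto

lemma nat_pow_mem_ideal_pow:
  assumes "ideal J R" "x \<in> J"
  shows "x [^] k \<in> ideal_pow R J k"
  by (induction k) (use assms in \<open>auto intro: ideal_prod.prod\<close>)

text \<open>Multiply an element of \<open>M\<close> outside \<open>Q\<close> by an element outside
  \<open>Q\<close> from each member of \<open>F\<close>; primality keeps the product outside
  \<open>Q\<close>.\<close>

lemma exists_common_element_outside_prime:
  assumes "finite F" "primeideal Q R" "ideal M R" "\<not> M \<subseteq> Q"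
    "\<And>Q'. Q' \<in> F \<Longrightarrow> ideal Q' R" "\<And>Q'. Q' \<in> F \<Longrightarrow> \<not> Q' \<subseteq> Q"
  shows "\<exists>y\<in>M. y \<notin> Q \<and> (\<forall>Q'\<in>F. y \<in> Q')"
  using assms(1,5,6)
proof (induction F rule: finite_induct)
  case empty
  then show ?case using assms(4) by blast
next
  case (insert P F)
  then obtain y where y: "y \<in> M" "y \<notin> Q" "\<forall>Q'\<in>F. y \<in> Q'"
    by blast
  obtain z where z: "z \<in> P" "z \<notin> Q"
    using insert by blast
  have P: "ideal P R" using insert by blast
  have c: "y \<in> carrier R" "z \<in> carrier R"
    using ideal.Icarr[OF assms(3)] ideal.Icarr[OF P] y z by auto
  have "y \<otimes> z \<in> M" "y \<otimes> z \<in> P"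
    using y z c ideal.I_r_closed[OF assms(3)] ideal.I_l_closed[OF P] by auto
  moreover have "\<forall>Q'\<in>F. y \<otimes> z \<in> Q'"
    using y(3) c(2) insert.prems(1) by (auto intro: ideal.I_r_closed)
  moreover have "y \<otimes> z \<notin> Q"
    using primeideal.I_prime[OF assms(2)] c y z by blast
  ultimately show ?case by blast
qed

lemma prime_avoidance:
  assumes "finite F" "ideal M R" "\<And>Q. Q \<in> F \<Longrightarrow> primeideal Q R" "\<And>Q. Q \<in> F \<Longrightarrow> \<not> M \<subseteq> Q"
  shows "\<exists>x\<in>M. \<forall>Q\<in>F. x \<notin> Q"
  using assms(1,3,4)
proof (induction F rule: finite_psubset_induct)
  case (psubset F)
  have IH: "\<exists>x\<in>M. \<forall>Q\<in>F - {P}. x \<notin> Q" if "P \<in> F" for P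
    using that psubset.prems by (intro psubset.IH) auto
  consider "F = {}" | Q P where "P \<in> F" "Q \<in> F" "P \<noteq> Q" "P \<subseteq> Q"
    | Q where "Q \<in> F" "\<And>P. P \<in> F - {Q} \<Longrightarrow> \<not> P \<subseteq> Q"
    by blast
  then show ?case
  proof cases
    case 1
    then show ?thesis using ideal_zero_closed[OF assms(2)] by blast
  next
    case 2
    then show ?thesis using IH[of P] by blast
  next
    case 3
    obtain x where x: "x \<in> M" "\<forall>P\<in>F - {Q}. x \<notin> P"
      using IH[OF 3(1)] by blast
    show ?thesis
    proof (cases "x \<in> Q")
      case False
      then show ?thesis using x by blast
    next
      case True
      obtain y where y: "y \<in> M" "y \<notin> Q" "\<forall>P\<in>F - {Q}. y \<in> P"
        using exists_common_element_outside_prime[of "F - {Q}" Q M, OF _ _ assms(2)] 3 psubset.hyps psubset.prems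
          primeideal.axioms(1) by (metis DiffD1 finite_Diff)
      have c: "x \<in> carrier R" "y \<in> carrier R"
        using ideal.Icarr[OF assms(2)] x y by auto
      have "x \<oplus> y \<notin> P" if "P \<in> F" for P
      proof -
        have P: "ideal P R" using psubset.prems(1)[OF that] by (rule primeideal.axioms(1))
        show ?thesis
        proof (cases "P = Q")
          case True
          then show ?thesis
            using ideal_add_cancel[OF P _ _ c(2)] \<open>x \<in> Q\<close> y by blast
        next
          case False
          then show ?thesis
            using ideal_add_cancel[OF P, of y x] c x y that by (metis DiffI a_comm singletonD)
        qed
      qed
      then show ?thesis
        using ideal_add_closed[OF assms(2) x(1) y(1)] by blast
    qed
  qed
qed

lemma genideal_insert_mult_subset:
  assumes "ideal A R" "a \<in> carrier R" "b \<in> carrier R" "a \<otimes> b \<in> A"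
  shows "(Idl (insert a A)) \<cdot> (Idl (insert b A)) \<subseteq> A"
proof (rule ideal_prod_least[OF assms(1)])
  have A: "A \<subseteq> carrier R" "Idl A = A"
    using ideal_subset_carrier[OF assms(1)] genideal_minimal[OF assms(1), of A] genideal_self[of A]
    by auto
  have carr': "insert a A \<subseteq> carrier R" "insert b A \<subseteq> carrier R"
    using A assms by auto
  fix x y assume xy: "x \<in> Idl (insert a A)" "y \<in> Idl (insert b A)"
  obtain c u where cu: "c \<in> carrier R" "u \<in> Idl A" "x = c \<otimes> a \<oplus> u"
    using genideal_insertE[OF carr'(1) xy(1)] .
  obtain d v where dv: "d \<in> carrier R" "v \<in> Idl A" "y = d \<otimes> b \<oplus> v"
    using genideal_insertE[OF carr'(2) xy(2)] .
  note * = cu dv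
  have carr: "u \<in> carrier R" "v \<in> carrier R" "y \<in> carrier R" using * A assms(3) by auto
  have "x \<otimes> y = (c \<otimes> d) \<otimes> (a \<otimes> b) \<oplus> ((c \<otimes> a) \<otimes> v \<oplus> y \<otimes> u)"
    unfolding *(3,6) using * carr assms(2,3) by algebra
  moreover have "(c \<otimes> d) \<otimes> (a \<otimes> b) \<in> A" "(c \<otimes> a) \<otimes> v \<in> A" "y \<otimes> u \<in> A"
    using * carr assms A(2) by (auto intro!: ideal.I_l_closed[OF assms(1)])
  ultimately show "x \<otimes> y \<in> A"
    using ideal_add_closed[OF assms(1)] by presburger
qed

end

section \<open>Noetherian induction and the primes over an ideal\<close>

locale noetherian_cring = cring R + noetherian_ring R for R (structure)
begin

lemma ascending_chain_stabilizes:
  assumes "\<And>n. ideal (f n) R" "\<And>n. f n \<subseteq> f (Suc n)"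
  shows "\<exists>n::nat. f (Suc n) = f n"
proof -
  have "f m \<subseteq> f n" if "m \<le> n" for m n
    using lift_Suc_mono_le[of f, OF assms(2) that] .
  then have "f m \<subseteq> f n \<or> f n \<subseteq> f m" for m n
    using nat_le_linear by blast
  then have "subset.chain {I. ideal I R} (range f)"
    unfolding pred_on.chain_def using assms(1) by blast
  then have "\<Union>(range f) \<in> range f"
    by (intro ideal_chain_is_trivial) auto
  then obtain n where "\<Union>(range f) = f n" by auto
  then show ?thesis using assms(2)[of n] by blast
qed

lemma noetherian_induct [consumes 1, case_names larger]:
  assumes "ideal A R" "\<And>A. ideal A R \<Longrightarrow> (\<And>B. ideal B R \<Longrightarrow> A \<subset> B \<Longrightarrow> P B) \<Longrightarrow> P A"
  shows "P A"
proof (rule ccontr)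
  assume nP: "\<not> P A"
  have "\<exists>f. \<forall>n. (ideal (f n) R \<and> \<not> P (f n)) \<and> f n \<subset> f (Suc n)"
  proof (rule dependent_nat_choice)
    fix B assume "ideal B R \<and> \<not> P B"
    then show "\<exists>C. (ideal C R \<and> \<not> P C) \<and> B \<subset> C"
      using assms(2)[of B] by blast
  qed (use assms(1) nP in blast)
  then obtain f where f: "\<And>n. ideal (f n) R" "\<And>n. f n \<subset> f (Suc n)"
    by blast
  then show False
    using ascending_chain_stabilizes[of f] f by blast
qed

lemma prime_or_factor:
  assumes "ideal A R"
  obtains "A = carrier R" | "primeideal A R" | a b where "a \<in> carrier R" "b \<in> carrier R"
    "a \<otimes> b \<in> A" "a \<notin> A" "b \<notin> A"
  using ideal.primeidealCD[OF assms is_cring] by blast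

text \<open>The set \<open>F\<close> contains all minimal primes over \<open>A\<close>, possibly
  with others. If \<open>a \<otimes> b \<in> A\<close> with neither factor in \<open>A\<close>,
  every prime over \<open>A\<close> contains one of the two larger ideals generated by
  \<open>A\<close> with \<open>a\<close> or with \<open>b\<close>, so their finite sets can be
  united.\<close>

lemma finitely_many_primes_below:
  assumes "ideal A R"
  shows "\<exists>F. finite F \<and> (\<forall>Q\<in>F. primeideal Q R \<and> A \<subseteq> Q) \<and>
    (\<forall>P. primeideal P R \<and> A \<subseteq> P \<longrightarrow> (\<exists>Q\<in>F. Q \<subseteq> P))"
  using assms
proof (induction rule: noetherian_induct)
  case (larger A)
  from larger(1) show ?case
  proof (cases rule: prime_or_factor)
    case 1
    have "P = carrier R" if "primeideal P R" "A \<subseteq> P" for P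
      using that 1 ideal_subset_carrier[OF primeideal.axioms(1)[OF that(1)]] by blast
    then have "\<not> (primeideal P R \<and> A \<subseteq> P)" for P
      using primeideal.I_notcarr by metis
    then show ?thesis by (intro exI[of _ "{}"]) auto
  next
    case 2
    then show ?thesis by (intro exI[of _ "{A}"]) auto
  next
    case (3 a b)
    have carr: "insert a A \<subseteq> carrier R" "insert b A \<subseteq> carrier R"
      using 3 ideal_subset_carrier[OF larger(1)] by auto
    have sub: "A \<subset> Idl (insert a A)" "A \<subset> Idl (insert b A)"
      using genideal_self[OF carr(1)] genideal_self[OF carr(2)] 3 by auto
    obtain F where F: "finite F" "\<forall>Q\<in>F. primeideal Q R \<and> Idl (insert a A) \<subseteq> Q"
        "\<forall>P. primeideal P R \<and> Idl (insert a A) \<subseteq> P \<longrightarrow> (\<exists>Q\<in>F. Q \<subseteq> P)"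
      using larger.IH[OF genideal_ideal[OF carr(1)] sub(1)] by blast
    obtain G where G: "finite G" "\<forall>Q\<in>G. primeideal Q R \<and> Idl (insert b A) \<subseteq> Q"
        "\<forall>P. primeideal P R \<and> Idl (insert b A) \<subseteq> P \<longrightarrow> (\<exists>Q\<in>G. Q \<subseteq> P)"
      using larger.IH[OF genideal_ideal[OF carr(2)] sub(2)] by blast
    have "\<exists>Q\<in>F \<union> G. Q \<subseteq> P" if P: "primeideal P R" "A \<subseteq> P" for P
    proof -
      have "a \<in> P \<or> b \<in> P"
        using primeideal.I_prime[OF P(1)] 3 P(2) by blast
      then show ?thesis
      proof
        assume "a \<in> P"
        then have "Idl (insert a A) \<subseteq> P"
          using P by (intro genideal_minimal primeideal.axioms(1)) auto
        then obtain Q where "Q \<in> F" "Q \<subseteq> P"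
          using F(3) P(1) by blast
        then show ?thesis by blast
      next
        assume "b \<in> P"
        then have "Idl (insert b A) \<subseteq> P"
          using P by (intro genideal_minimal primeideal.axioms(1)) auto
        then obtain Q where "Q \<in> G" "Q \<subseteq> P"
          using G(3) P(1) by blast
        then show ?thesis by blast
      qed
    qed
    moreover have "\<forall>Q\<in>F \<union> G. primeideal Q R \<and> A \<subseteq> Q"
      using F(2) G(2) sub by (meson UnE psubset_imp_subset subset_trans)
    ultimately show ?thesis
      using F(1) G(1) finite_UnI by metis
  qed
qed

text \<open>The hypothesis passes to larger ideals. In the composite case the exponents
  \<open>s\<close> and \<open>t\<close> of the two enlargements add up, since the product of these
  enlargements lies in \<open>A\<close> by \<open>genideal_insert_mult_subset\<close>.\<close>

lemma power_subset_of_unique_prime: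
  assumes "ideal A R" "ideal M R" "\<And>P. primeideal P R \<Longrightarrow> A \<subseteq> P \<Longrightarrow> P = M"
  shows "\<exists>s. ideal_pow R M s \<subseteq> A"
  using assms(1,3)
proof (induction rule: noetherian_induct)
  case (larger A)
  from larger(1) show ?case
  proof (cases rule: prime_or_factor)
    case 1
    then show ?thesis by (intro exI[of _ 0]) auto
  next
    case 2
    then have "A = M" using larger.prems by auto
    moreover have "ideal_pow R M 1 \<subseteq> M"
      using ideal_prod_inter[OF oneideal assms(2)] by auto
    ultimately show ?thesis by blast
  next
    case (3 a b)
    have carr: "insert a A \<subseteq> carrier R" "insert b A \<subseteq> carrier R"
      using 3 ideal_subset_carrier[OF larger(1)] by auto
    have sub: "A \<subset> Idl (insert a A)" "A \<subset> Idl (insert b A)"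
      using genideal_self[OF carr(1)] genideal_self[OF carr(2)] 3 by auto
    obtain s where "ideal_pow R M s \<subseteq> Idl (insert a A)"
      using larger.IH[OF genideal_ideal[OF carr(1)] sub(1)] larger.prems sub(1) by blast
    moreover obtain t where "ideal_pow R M t \<subseteq> Idl (insert b A)"
      using larger.IH[OF genideal_ideal[OF carr(2)] sub(2)] larger.prems sub(2) by blast
    ultimately have "ideal_pow R M (s + t) \<subseteq> (Idl (insert a A)) \<cdot> (Idl (insert b A))"
      unfolding ideal_pow_add[OF assms(2)] by (rule ideal_prod_mono)
    also have "\<dots> \<subseteq> A"
      using 3 larger(1) by (intro genideal_insert_mult_subset)
    finally show ?thesis by blast
  qed
qed

lemma proper_ideal_subset_maximal:
  assumes "ideal A R" "A \<noteq> carrier R"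
  shows "\<exists>M. maximalideal M R \<and> A \<subseteq> M"
  using assms
proof (induction rule: noetherian_induct)
  case (larger A)
  show ?case
  proof (cases "maximalideal A R")
    case False
    then obtain B where "ideal B R" "A \<subset> B" "B \<noteq> carrier R"
      using maximalidealI[OF larger(1)] larger.prems ideal_subset_carrier by (metis psubsetI)
    then show ?thesis using larger.IH[of B] by blast
  qed auto
qed

end

section \<open>Parameters of a local ring and ideals of controlled colength\<close>

locale noetherian_local_ring = noetherian_cring R for R (structure) +
  fixes M
  assumes max: "maximalideal M R" and unique_max: "\<And>N. maximalideal N R \<Longrightarrow> N = M"
begin

lemma max_ideal_ideal: "ideal M R"
  using max by (rule maximalideal.axioms(1))

lemma prime_subset_max:
  assumes "primeideal P R"
  shows "P \<subseteq> M"
  using proper_ideal_subset_maximal[of P] primeideal.axioms(1)[OF assms]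
    primeideal.I_notcarr[OF assms] unique_max by metis

text \<open>For a prime \<open>P\<close> this says that its height is at least
  \<open>i\<close>.\<close>

definition prime_chain_to :: "nat \<Rightarrow> 'a set \<Rightarrow> bool" where
  "prime_chain_to i P \<longleftrightarrow>
    (\<exists>c. (\<forall>j\<le>i. primeideal (c j) R) \<and> (\<forall>j<i. c j \<subset> c (Suc j)) \<and> c i = P)"

lemma prime_chain_to_extend:
  assumes "prime_chain_to i P" "P \<subset> Q" "primeideal Q R"
  shows "prime_chain_to (Suc i) Q"
proof -
  obtain c where c: "\<forall>j\<le>i. primeideal (c j) R" "\<forall>j<i. c j \<subset> c (Suc j)" "c i = P"
    using assms(1) unfolding prime_chain_to_def by blast
  show ?thesis
    using strict_chain_extend[OF c(1,2), of Q] assms(2,3) c(3) unfolding prime_chain_to_def by simp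
qed

text \<open>Each new element avoids the minimal primes over the previous ones, so any prime
  containing it lies strictly above one of them and the height grows by one. The bound on
  \<open>card Y\<close> is an inequality because the new element may already belong to
  \<open>Y\<close>.\<close>

lemma partial_parameters:
  "\<exists>Y\<subseteq>M. finite Y \<and> card Y \<le> i \<and> (\<forall>P. primeideal P R \<and> Y \<subseteq> P \<longrightarrow> P = M \<or> prime_chain_to i P)"
proof (induction i)
  case 0
  have "prime_chain_to 0 P" if "primeideal P R" for P
    using that unfolding prime_chain_to_def by (intro exI[of _ "\<lambda>_. P"]) simp
  then show ?case
    by (intro exI[of _ "{}"]) simp
next
  case (Suc i)
  then obtain Y where Y: "Y \<subseteq> M" "finite Y" "card Y \<le> i" and
    ch: "\<And>P. primeideal P R \<Longrightarrow> Y \<subseteq> P \<Longrightarrow> P \<noteq> M \<Longrightarrow> prime_chain_to i P"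
    by blast
  have Yc: "Y \<subseteq> carrier R" using Y ideal_subset_carrier[OF max_ideal_ideal] by auto
  obtain F where F: "finite F" "\<forall>Q\<in>F. primeideal Q R \<and> Idl Y \<subseteq> Q"
     "\<forall>P. primeideal P R \<and> Idl Y \<subseteq> P \<longrightarrow> (\<exists>Q\<in>F. Q \<subseteq> P)"
    using finitely_many_primes_below[OF genideal_ideal[OF Yc]] by blast
  \<comment> \<open>The new element has to come from \<open>M\<close>, so \<open>M\<close> itself
    cannot be avoided; this is why the conclusion exempts \<open>P = M\<close>.\<close>
  have "\<not> M \<subseteq> Q" if "Q \<in> F - {M}" for Q
    using that F(2) prime_subset_max[of Q] by blast
  then have "\<exists>x\<in>M. \<forall>Q\<in>F - {M}. x \<notin> Q"
    using F(1,2) by (intro prime_avoidance max_ideal_ideal) blast+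
  then obtain x where x: "x \<in> M" "\<forall>Q\<in>F - {M}. x \<notin> Q"
    by blast
  have "prime_chain_to (Suc i) P"
    if P: "primeideal P R" "insert x Y \<subseteq> P" "P \<noteq> M" for P
  proof -
    have "Idl Y \<subseteq> P"
      using genideal_minimal[OF primeideal.axioms(1)[OF P(1)], of Y] P(2) by simp
    then obtain Q where Q: "Q \<in> F" "Q \<subseteq> P"
      using F(3) P(1) by blast
    have "Q \<noteq> M"
      using Q prime_subset_max[OF P(1)] P(3) by blast
    moreover have "Y \<subseteq> Q"
      using F(2) Q genideal_self[OF Yc] by blast
    ultimately have "prime_chain_to i Q"
      using ch[of Q] F(2) Q by blast
    moreover have "Q \<subset> P"
      using Q P(2) x(2) \<open>Q \<noteq> M\<close> by blast
    ultimately show ?thesis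
      using P(1) by (rule prime_chain_to_extend)
  qed
  moreover have "card (insert x Y) \<le> Suc i"
    using Y by (simp add: card_insert_if)
  moreover have "insert x Y \<subseteq> M" "finite (insert x Y)"
    using Y x(1) by auto
  ultimately show ?case
    by blast
qed

text \<open>A prime \<open>P \<noteq> M\<close> over \<open>Y\<close> would have height at least
  \<open>d\<close>, and \<open>M\<close> would then have height at least \<open>Suc d\<close>,
  exceeding the dimension. So \<open>M\<close> is the only prime over \<open>Y\<close>, and a power
  of it lies in the ideal generated by \<open>Y\<close>.\<close>

lemma exists_parameters:
  assumes "krull_dim R = enat d"
  shows "\<exists>Y s. Y \<subseteq> M \<and> finite Y \<and> card Y \<le> d \<and> ideal_pow R M s \<subseteq> Idl Y"
proof -
  obtain Y where Y: "Y \<subseteq> M" "finite Y" "card Y \<le> d" and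
    ch: "\<And>P. primeideal P R \<Longrightarrow> Y \<subseteq> P \<Longrightarrow> P \<noteq> M \<Longrightarrow> prime_chain_to d P"
    using partial_parameters[of d] by blast
  have Yc: "Y \<subseteq> carrier R" using Y ideal_subset_carrier[OF max_ideal_ideal] by auto
  have "P = M" if P: "primeideal P R" "Idl Y \<subseteq> P" for P
  proof (rule ccontr)
    assume "P \<noteq> M"
    then have "prime_chain_to d P"
      using ch[of P] P genideal_self[OF Yc] by blast
    moreover have "P \<subset> M"
      using \<open>P \<noteq> M\<close> prime_subset_max[OF P(1)] by blast
    ultimately have "prime_chain_to (Suc d) M"
      using maximalideal_prime[OF max] by (rule prime_chain_to_extend)
    then have "\<exists>c. (\<forall>i\<le>Suc d. primeideal (c i) R) \<and> (\<forall>i<Suc d. c i \<subset> c (Suc i))"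
      unfolding prime_chain_to_def by blast
    then have "enat (Suc d) \<le> krull_dim R"
      unfolding krull_dim_def by (intro Sup_upper) blast
    then show False using assms by simp
  qed
  then obtain s where "ideal_pow R M s \<subseteq> Idl Y"
    using power_subset_of_unique_prime[OF genideal_ideal[OF Yc] max_ideal_ideal] by blast
  then show ?thesis using Y by blast
qed

lemma exists_small_colength:
  assumes "krull_dim R = enat d"
  shows "\<exists>l. \<forall>k>0. \<exists>Q. ideal Q R \<and> Q \<subseteq> ideal_pow R M k \<and> length_le Q (carrier R) (l * k ^ d)"
proof -
  obtain Y s where Y: "Y \<subseteq> M" "finite Y" "card Y \<le> d" "ideal_pow R M s \<subseteq> Idl Y"
    using exists_parameters[OF assms] by blast
  have Yc: "Y \<subseteq> carrier R" using Y ideal_subset_carrier[OF max_ideal_ideal] by auto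
  have pow_sub: "Idl ((\<lambda>x. x [^] k) ` Z) \<subseteq> ideal_pow R M k" if "Z \<subseteq> M" for Z and k :: nat
    using that nat_pow_mem_ideal_pow[OF max_ideal_ideal]
    by (intro genideal_minimal ideal_pow_ideal max_ideal_ideal) auto
  obtain Z where Z: "Z \<subseteq> carrier R" "finite Z" "M = Idl Z"
    using finetely_gen[OF max_ideal_ideal] by blast
  \<comment> \<open>A first finite colength, starting from colength 1 for \<open>M\<close>: the
    \<open>s\<close>-th powers of generators of \<open>M\<close> lie in
    \<open>ideal_pow R M s\<close>, hence in \<open>Idl Y\<close>. This provides the constant
    \<open>s ^ card Z\<close>, which does not depend on \<open>k\<close>.\<close>
  have "length_le (Idl ((\<lambda>x. x [^] s) ` Z \<union> {})) (carrier R) (s ^ card Z * 1)"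
    using Z length_le_maximal[OF max] by (intro length_le_power_generators) auto
  then have lenZ: "length_le (Idl ((\<lambda>x. x [^] s) ` Z)) (carrier R) (s ^ card Z)"
    by simp
  have "Z \<subseteq> M"
    unfolding Z(3) by (rule genideal_self[OF Z(1)])
  then have "length_le (Idl Y) (carrier R) (s ^ card Z)"
    by (intro length_le_mono[OF lenZ subset_trans[OF pow_sub Y(4)]]) auto
  then have len: "length_le (Idl ((\<lambda>x. x [^] k) ` Y \<union> {})) (carrier R) (k ^ card Y * s ^ card Z)"
    for k :: nat
    by (intro length_le_power_generators) (use Y(2) Yc in simp_all)
  have "\<exists>Q. ideal Q R \<and> Q \<subseteq> ideal_pow R M k \<and> length_le Q (carrier R) (s ^ card Z * k ^ d)"
    if "k > 0" for k :: nat
  proof (intro exI conjI)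
    show "ideal (Idl ((\<lambda>x. x [^] k) ` Y)) R"
      using Yc by (intro genideal_ideal) auto
    show "Idl ((\<lambda>x. x [^] k) ` Y) \<subseteq> ideal_pow R M k"
      by (rule pow_sub[OF Y(1)])
    \<comment> \<open>Here \<open>card Y\<close> may be smaller than \<open>d\<close>; positivity of
      \<open>k\<close> allows the exponent to be raised.\<close>
    have "k ^ card Y * s ^ card Z \<le> s ^ card Z * k ^ d"
      using that Y(3) by (simp add: power_increasing mult.commute)
    then show "length_le (Idl ((\<lambda>x. x [^] k) ` Y)) (carrier R) (s ^ card Z * k ^ d)"
      using len[of k] length_le_weaken by simp
  qed
  then show ?thesis by blast
qed

end

section \<open>Graded finite generation\<close>

lemma nat_nondecreasing_subsequence:
  fixes s :: "nat \<Rightarrow> nat"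
  shows "\<exists>\<phi>::nat \<Rightarrow> nat. strict_mono \<phi> \<and> (\<forall>m n. m \<le> n \<longrightarrow> s (\<phi> m) \<le> s (\<phi> n))"
proof -
  obtain f where f: "strict_mono f" "monoseq (\<lambda>n. s (f n))"
    using seq_monosub[of s] by metis
  show ?thesis
  proof (cases "\<forall>m n. m \<le> n \<longrightarrow> s (f m) \<le> s (f n)")
    case True
    then show ?thesis using f by blast
  next
    case False
    then have dec: "s (f n) \<le> s (f m)" if "m \<le> n" for m n
      using f(2) that unfolding monoseq_def by blast
    \<comment> \<open>A nonincreasing sequence of natural numbers is constant from the place of its
      least value on.\<close>
    obtain N where N: "\<And>n. s (f N) \<le> s (f n)"
      using ex_has_least_nat[of "\<lambda>_. True" _ "\<lambda>n. s (f n)"] by blast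
    have "s (f (N + n)) = s (f N)" for n
      using dec[of N "N + n"] N[of "N + n"] by simp
    moreover have "strict_mono (\<lambda>n. f (N + n))"
      using f(1) by (simp add: strict_mono_def)
    ultimately show ?thesis
      by (intro exI[of _ "\<lambda>n. f (N + n)"]) simp
  qed
qed

lemma dickson_subsequence:
  fixes a :: "nat \<Rightarrow> nat \<Rightarrow> nat"
  shows "\<exists>\<phi>::nat \<Rightarrow> nat. strict_mono \<phi> \<and> (\<forall>j<p. \<forall>m n. m \<le> n \<longrightarrow> a (\<phi> m) j \<le> a (\<phi> n) j)"
proof (induction p)
  case 0
  show ?case by (intro exI[of _ id]) (simp add: strict_mono_def)
next
  case (Suc p)
  then obtain \<phi> :: "nat \<Rightarrow> nat" where \<phi>: "strict_mono \<phi>" "\<And>j m n. j < p \<Longrightarrow> m \<le> n \<Longrightarrow> a (\<phi> m) j \<le> a (\<phi> n) j"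
    by blast
  obtain \<psi> :: "nat \<Rightarrow> nat" where \<psi>: "strict_mono \<psi>" "\<And>m n. m \<le> n \<Longrightarrow> a (\<phi> (\<psi> m)) p \<le> a (\<phi> (\<psi> n)) p"
    using nat_nondecreasing_subsequence[of "\<lambda>n. a (\<phi> n) p"] by blast
  have "a (\<phi> (\<psi> m)) j \<le> a (\<phi> (\<psi> n)) j" if "j < Suc p" "m \<le> n" for j m n
    using that \<phi>(2) \<psi>(2) strict_mono_less_eq[OF \<psi>(1)] by (cases "j = p") auto
  moreover have "strict_mono (\<lambda>n. \<phi> (\<psi> n))"
    using \<phi>(1) \<psi>(1) by (simp add: strict_mono_def)
  ultimately show ?case by blast
qed

section \<open>Exponents, multidegrees and the lexicographic order\<close>

definition exponents :: "nat \<Rightarrow> (nat \<Rightarrow> nat) set" where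
  "exponents p = {\<alpha>. \<forall>j\<ge>p. \<alpha> j = 0}"

text \<open>The degree of the monomial with exponent \<open>\<alpha>\<close> when the
  \<open>j\<close>-th variable is given the \<open>\<delta> j\<close>-th unit vector as its
  degree.\<close>

definition multideg :: "(nat \<Rightarrow> nat) \<Rightarrow> nat \<Rightarrow> (nat \<Rightarrow> nat) \<Rightarrow> nat \<Rightarrow> nat" where
  "multideg \<delta> p \<alpha> = (\<lambda>i. \<Sum>j<p. if \<delta> j = i then \<alpha> j else 0)"

lemma exponents_add: "\<alpha> \<in> exponents p \<Longrightarrow> \<beta> \<in> exponents p \<Longrightarrow> \<alpha> + \<beta> \<in> exponents p"
  by (simp add: exponents_def)

lemma exponents_diff: "\<alpha> \<in> exponents p \<Longrightarrow> \<alpha> - \<beta> \<in> exponents p"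
  by (simp add: exponents_def)

lemma multideg_add: "multideg \<delta> p (\<alpha> + \<beta>) = multideg \<delta> p \<alpha> + multideg \<delta> p \<beta>"
  unfolding multideg_def
  by (rule ext) (simp flip: sum.distrib, rule sum.cong, auto)

lemma diff_add_exponent: "f \<le> \<alpha> \<Longrightarrow> (\<alpha> - f) + f = (\<alpha> :: nat \<Rightarrow> nat)"
  by (auto simp: le_fun_def)

text \<open>Each entry \<open>\<alpha> j\<close> is bounded by the entry of the degree at
  \<open>\<delta> j\<close>. Finiteness lets the reduction of leading monomials within one degree
  terminate.\<close>

lemma finite_multideg: "finite {\<alpha> \<in> exponents p. multideg \<delta> p \<alpha> = b}"
proof (rule finite_subset)
  let ?B = "\<Union>j<p. {..b (\<delta> j)}"
  show "finite {\<alpha>. \<forall>j. (j \<in> {..<p} \<longrightarrow> \<alpha> j \<in> ?B) \<and> (j \<notin> {..<p} \<longrightarrow> \<alpha> j = 0)}"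
    by (intro finite_set_of_finite_funs) auto
  have "\<alpha> j \<le> multideg \<delta> p \<alpha> (\<delta> j)" if "j < p" for \<alpha> j
    unfolding multideg_def
    using member_le_sum[of j "{..<p}" "\<lambda>k. if \<delta> k = \<delta> j then \<alpha> k else 0"] that by simp
  then have "\<alpha> j \<in> ?B" if "multideg \<delta> p \<alpha> = b" "j < p" for \<alpha> j
    using that by blast
  then show "{\<alpha> \<in> exponents p. multideg \<delta> p \<alpha> = b} \<subseteq>
      {\<alpha>. \<forall>j. (j \<in> {..<p} \<longrightarrow> \<alpha> j \<in> ?B) \<and> (j \<notin> {..<p} \<longrightarrow> \<alpha> j = 0)}"
    unfolding exponents_def by (simp add: subset_iff)
qed

lemma less_fun_add:
  fixes \<alpha> \<beta> \<gamma> :: "nat \<Rightarrow> nat"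
  shows "less_fun \<alpha> \<beta> \<Longrightarrow> less_fun (\<gamma> + \<alpha>) (\<gamma> + \<beta>)"
  by (auto simp: less_fun_def)

text \<open>Two exponents differ at finitely many places only, so the lexicographic order is total
  on them.\<close>

lemma exponents_lex_max:
  assumes "finite Y" "Y \<noteq> {}" "Y \<subseteq> exponents p"
  shows "\<exists>\<alpha>\<in>Y. \<forall>\<beta>\<in>Y. \<beta> = \<alpha> \<or> less_fun \<beta> \<alpha>"
  using assms
proof (induction Y rule: finite_ne_induct)
  case (singleton x)
  then show ?case by simp
next
  case (insert x Y)
  then obtain \<alpha> where \<alpha>: "\<alpha> \<in> Y" "\<forall>\<beta>\<in>Y. \<beta> = \<alpha> \<or> less_fun \<beta> \<alpha>"
    by auto
  have "x \<in> exponents p" "\<alpha> \<in> exponents p"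
    using insert.prems \<alpha>(1) by auto
  then have "{k. x k \<noteq> \<alpha> k} \<subseteq> {..<p}"
    unfolding exponents_def by (auto simp flip: not_le)
  then have "less_fun x \<alpha> \<or> x = \<alpha> \<or> less_fun \<alpha> x"
    by (intro less_fun_trichotomy finite_subset[OF _ finite_lessThan])
  then consider "less_fun x \<alpha> \<or> x = \<alpha>" | "less_fun \<alpha> x"
    by blast
  then show ?case
  proof cases
    case 1
    then show ?thesis using \<alpha> by (intro bexI[of _ \<alpha>]) auto
  next
    case 2
    have "less_fun \<beta> x" if "\<beta> \<in> Y" for \<beta>
      using \<alpha>(2) that 2 less_fun_trans[of \<beta> \<alpha> x] by auto
    then show ?thesis by (intro bexI[of _ x]) auto
  qed
qed

context cring
begin

primrec mon :: "(nat \<Rightarrow> 'a) \<Rightarrow> nat \<Rightarrow> (nat \<Rightarrow> nat) \<Rightarrow> 'a" where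
  "mon g 0 \<alpha> = \<one>"
| "mon g (Suc p) \<alpha> = mon g p \<alpha> \<otimes> g p [^] \<alpha> p"

lemma mon_closed: "(\<And>j. j < p \<Longrightarrow> g j \<in> carrier R) \<Longrightarrow> mon g p \<alpha> \<in> carrier R"
  by (induction p) auto

lemma mon_add:
  "(\<And>j. j < p \<Longrightarrow> g j \<in> carrier R) \<Longrightarrow> mon g p (\<alpha> + \<beta>) = mon g p \<alpha> \<otimes> mon g p \<beta>"
proof (induction p)
  case (Suc p)
  have c: "mon g p \<alpha> \<in> carrier R" "mon g p \<beta> \<in> carrier R" "g p [^] \<alpha> p \<in> carrier R"
    "g p [^] \<beta> p \<in> carrier R" "g p \<in> carrier R"
    using Suc.prems by (auto intro: mon_closed)
  have IH: "mon g p (\<alpha> + \<beta>) = mon g p \<alpha> \<otimes> mon g p \<beta>"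
    using Suc.prems by (intro Suc.IH) simp
  show ?case
    using c IH by (simp add: plus_fun_def nat_pow_mult[symmetric] m_ac)
qed simp

end

context noetherian_cring
begin

text \<open>Dickson's lemma and the ascending chain condition combined: a sequence of
  counterexamples has a subsequence with pointwise growing exponents, along which \<open>L\<close>
  ascends and must repeat a value.\<close>

lemma finitely_many_exponents_suffice:
  assumes "\<And>\<alpha>. \<alpha> \<in> exponents p \<Longrightarrow> ideal (L \<alpha>) R"
    "\<And>\<alpha> \<beta>. \<alpha> \<in> exponents p \<Longrightarrow> \<beta> \<in> exponents p \<Longrightarrow> \<alpha> \<le> \<beta> \<Longrightarrow> L \<alpha> \<subseteq> L \<beta>"
  shows "\<exists>A. finite A \<and> A \<subseteq> exponents p \<and> (\<forall>\<alpha>\<in>exponents p. \<exists>f\<in>A. f \<le> \<alpha> \<and> L f = L \<alpha>)"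
proof (rule ccontr)
  assume neg: "\<not> ?thesis"
  \<comment> \<open>Each \<open>h n\<close> is an exponent for which the finite set of its
    predecessors offers no suitable \<open>f\<close>.\<close>
  have "\<exists>h::nat \<Rightarrow> nat \<Rightarrow> nat. \<forall>n. h n \<in> exponents p \<and> (\<forall>m<n. \<not> (h m \<le> h n \<and> L (h m) = L (h n)))"
  proof (rule dependent_wellorder_choice[where
        P = "\<lambda>h n r. r \<in> exponents p \<and> (\<forall>m<n. \<not> (h m \<le> r \<and> L (h m) = L r))"])
    fix h :: "nat \<Rightarrow> nat \<Rightarrow> nat" and n :: nat
    assume "\<And>m. m < n \<Longrightarrow> h m \<in> exponents p \<and> (\<forall>k<m. \<not> (h k \<le> h m \<and> L (h k) = L (h m)))"
    then have "h ` {..<n} \<subseteq> exponents p" by auto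
    then show "\<exists>r. r \<in> exponents p \<and> (\<forall>m<n. \<not> (h m \<le> r \<and> L (h m) = L r))"
      using neg by (metis finite_imageI finite_lessThan imageI lessThan_iff)
  qed simp
  then obtain h :: "nat \<Rightarrow> nat \<Rightarrow> nat" where h: "\<And>n. h n \<in> exponents p"
      "\<And>m n. m < n \<Longrightarrow> \<not> (h m \<le> h n \<and> L (h m) = L (h n))"
    by blast
  obtain \<phi> :: "nat \<Rightarrow> nat" where \<phi>: "strict_mono \<phi>" "\<And>j m n. j < p \<Longrightarrow> m \<le> n \<Longrightarrow> h (\<phi> m) j \<le> h (\<phi> n) j"
    using dickson_subsequence[of p h] by blast
  have le: "h (\<phi> n) \<le> h (\<phi> (Suc n))" for n
    unfolding le_fun_def
  proof
    fix j
    show "h (\<phi> n) j \<le> h (\<phi> (Suc n)) j"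
      using \<phi>(2)[of j n "Suc n"] h(1)[of "\<phi> n"] by (cases "j < p") (auto simp: exponents_def)
  qed
  obtain n where "L (h (\<phi> (Suc n))) = L (h (\<phi> n))"
    using ascending_chain_stabilizes[of "\<lambda>n. L (h (\<phi> n))"] assms h(1) le by blast
  then show False
    using h(2)[of "\<phi> n" "\<phi> (Suc n)"] le[of n] \<phi>(1) by (simp add: strict_mono_def)
qed

text \<open>A graded Hilbert basis theorem for the Rees algebra of the family of ideals whose generators
  \<open>g j\<close> are placed in degree \<open>\<delta> j\<close>. The ideal \<open>L \<alpha>\<close> consists of the leading coefficients, for the
  lexicographic order, of the expressions of elements of \<open>H\<close> as combinations of monomials.\<close>

lemma graded_finite_generation:
  assumes g: "\<And>j. j < p \<Longrightarrow> g j \<in> carrier R"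
    and Hid: "\<And>b. ideal (H b) R"
    and Hsub: "\<And>b. H b \<subseteq> Idl (mon g p ` {\<alpha> \<in> exponents p. multideg \<delta> p \<alpha> = b})"
    and Hmul: "\<And>\<alpha> b h. \<alpha> \<in> exponents p \<Longrightarrow> h \<in> H b \<Longrightarrow> mon g p \<alpha> \<otimes> h \<in> H (multideg \<delta> p \<alpha> + b)"
  shows "\<exists>E. finite E \<and> (\<forall>b D. ideal D R \<longrightarrow>
    (\<forall>f\<in>E. \<forall>\<alpha>\<in>exponents p. \<forall>h\<in>H f. multideg \<delta> p \<alpha> + f = b \<longrightarrow> mon g p \<alpha> \<otimes> h \<in> D) \<longrightarrow> H b \<subseteq> D)"
proof -
  let ?m = "mon g p" and ?d = "multideg \<delta> p"
  note mc = mon_closed[of p g, OF g]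
  \<comment> \<open>Since the monomials may be dependent, \<open>c \<in> L \<alpha>\<close> only
    says that some element of \<open>H\<close> has an expression with leading term
    \<open>c \<otimes> ?m \<alpha>\<close>, up to the span \<open>W \<alpha>\<close> of the smaller
    monomials of the same degree.\<close>
  define S where "S \<alpha> = {\<beta> \<in> exponents p. ?d \<beta> = ?d \<alpha> \<and> less_fun \<beta> \<alpha>}" for \<alpha>
  define W where "W \<alpha> = Idl (?m ` S \<alpha>)" for \<alpha>
  define L where "L \<alpha> = {c \<in> carrier R. c \<otimes> ?m \<alpha> \<in> H (?d \<alpha>) <+> W \<alpha>}" for \<alpha>
  have img: "?m ` B \<subseteq> carrier R" for B using mc by auto
  have Wid: "ideal (W \<alpha>) R" for \<alpha>
    unfolding W_def by (rule genideal_ideal[OF img])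
  have Lid: "ideal (L \<alpha>) R" for \<alpha>
    unfolding L_def by (intro preimage_mult_ideal add_ideals Hid Wid mc)
  have Wmul: "?m \<gamma> \<otimes> w \<in> W (\<gamma> + f)" if \<gamma>: "\<gamma> \<in> exponents p" and w: "w \<in> W f" for \<gamma> f w
  proof -
    let ?K = "{a \<in> carrier R. a \<otimes> ?m \<gamma> \<in> W (\<gamma> + f)}"
    have "W f \<subseteq> ?K"
      unfolding W_def[of f]
    proof (rule genideal_minimal)
      show "ideal ?K R" by (intro preimage_mult_ideal Wid mc)
      show "?m ` S f \<subseteq> ?K"
      proof
        fix x assume "x \<in> ?m ` S f"
        then obtain \<beta> where \<beta>: "\<beta> \<in> S f" "x = ?m \<beta>" by blast
        have "\<gamma> + \<beta> \<in> S (\<gamma> + f)"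
          using \<beta>(1) \<gamma> unfolding S_def
          by (simp add: exponents_add multideg_add less_fun_add)
        then have "?m (\<gamma> + \<beta>) \<in> W (\<gamma> + f)"
          unfolding W_def using genideal_self[OF img] by blast
        then show "x \<in> ?K"
          using \<beta>(2) mc by (simp add: mon_add[of p g, OF g] m_comm)
      qed
    qed
    then have "w \<otimes> ?m \<gamma> \<in> W (\<gamma> + f)" "w \<in> carrier R" using w by auto
    then show ?thesis using mc by (simp add: m_comm)
  qed
  have Lmono: "L f \<subseteq> L \<alpha>" if "f \<in> exponents p" "\<alpha> \<in> exponents p" "f \<le> \<alpha>" for f \<alpha>
  proof
    fix c assume c: "c \<in> L f"
    let ?\<gamma> = "\<alpha> - f"
    have ga: "?\<gamma> \<in> exponents p" "?\<gamma> + f = \<alpha>"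
      using that by (auto intro: exponents_diff diff_add_exponent)
    have cc: "c \<in> carrier R" using c by (simp add: L_def)
    obtain h w where hw: "h \<in> H (?d f)" "w \<in> W f" "c \<otimes> ?m f = h \<oplus> w"
      using c unfolding L_def sum_ideals_iff by blast
    have hc: "h \<in> carrier R" "w \<in> carrier R"
      using hw ideal.Icarr[OF Hid] ideal.Icarr[OF Wid] by blast+
    have "c \<otimes> ?m \<alpha> = c \<otimes> (?m ?\<gamma> \<otimes> ?m f)"
      using mon_add[of p g ?\<gamma> f, OF g] ga(2) by simp
    also have "\<dots> = ?m ?\<gamma> \<otimes> (c \<otimes> ?m f)"
      using cc mc by (simp add: m_lcomm)
    also have "\<dots> = ?m ?\<gamma> \<otimes> h \<oplus> ?m ?\<gamma> \<otimes> w"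
      unfolding hw(3) using hc mc by (simp add: r_distr)
    finally have "c \<otimes> ?m \<alpha> = ?m ?\<gamma> \<otimes> h \<oplus> ?m ?\<gamma> \<otimes> w" .
    moreover have "?m ?\<gamma> \<otimes> h \<in> H (?d \<alpha>)"
      using Hmul[OF ga(1) hw(1)] multideg_add[of \<delta> p ?\<gamma> f] ga(2) by simp
    moreover have "?m ?\<gamma> \<otimes> w \<in> W \<alpha>"
      using Wmul[OF ga(1) hw(2)] ga(2) by simp
    ultimately show "c \<in> L \<alpha>"
      unfolding L_def sum_ideals_iff using cc by blast
  qed
  obtain A where A: "finite A" "A \<subseteq> exponents p" "\<And>\<alpha>. \<alpha> \<in> exponents p \<Longrightarrow> \<exists>f\<in>A. f \<le> \<alpha> \<and> L f = L \<alpha>"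
    using finitely_many_exponents_suffice[of p L, OF Lid Lmono] by blast
  \<comment> \<open>The finite set recorded is one of degrees, not of elements. Quantifying over all
    ideals \<open>D\<close> expresses that \<open>H b\<close> is generated by the products of
    monomials with the components \<open>H f\<close>.\<close>
  have "H b \<subseteq> D" if D: "ideal D R" and
    gen: "\<forall>f\<in>?d ` A. \<forall>\<alpha>\<in>exponents p. \<forall>h\<in>H f. ?d \<alpha> + f = b \<longrightarrow> ?m \<alpha> \<otimes> h \<in> D" for b D
  proof -
    let ?B = "{\<alpha> \<in> exponents p. ?d \<alpha> = b}"
    \<comment> \<open>Induction on the set of monomials in use. It is kept closed under smaller
      exponents of the same degree, so that removing its largest member \<open>\<alpha>\<close>
      leaves exactly \<open>S \<alpha>\<close>.\<close>
    have main: "H b \<inter> Idl (?m ` Y) \<subseteq> D"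
      if "finite Y" "Y \<subseteq> ?B" "\<And>\<alpha> \<beta>. \<alpha> \<in> Y \<Longrightarrow> \<beta> \<in> ?B \<Longrightarrow> less_fun \<beta> \<alpha> \<Longrightarrow> \<beta> \<in> Y" for Y
      using that
    proof (induction Y rule: finite_psubset_induct)
      case (psubset Y)
      show ?case
      proof (cases "Y = {}")
        case True
        have "Idl (?m ` Y) \<subseteq> {\<zero>}"
          unfolding True using genideal_minimal[OF zeroideal, of "{}"] by simp
        then show ?thesis using ideal_zero_closed[OF D] by auto
      next
        case False
        have "Y \<subseteq> exponents p" using psubset.prems(1) by blast
        then obtain \<alpha> where \<alpha>: "\<alpha> \<in> Y" "\<And>\<beta>. \<beta> \<in> Y \<Longrightarrow> \<beta> = \<alpha> \<or> less_fun \<beta> \<alpha>"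
          using exponents_lex_max[OF psubset.hyps False] by blast
        have \<alpha>e: "\<alpha> \<in> exponents p" "?d \<alpha> = b" using psubset.prems(1) \<alpha>(1) by auto
        have S: "S \<alpha> = Y - {\<alpha>}"
          using psubset.prems \<alpha> \<alpha>e less_fun_irrefl unfolding S_def by blast
        have IH: "H b \<inter> Idl (?m ` (Y - {\<alpha>})) \<subseteq> D"
        proof (rule psubset.IH)
          show "Y - {\<alpha>} \<subset> Y" "Y - {\<alpha>} \<subseteq> ?B" using \<alpha>(1) psubset.prems(1) by auto
          fix \<beta> \<beta>' assume "\<beta> \<in> Y - {\<alpha>}" "\<beta>' \<in> ?B" "less_fun \<beta>' \<beta>"
          then show "\<beta>' \<in> Y - {\<alpha>}"
            using psubset.prems(2)[of \<beta> \<beta>'] \<alpha>(2)[of \<beta>] less_fun_asym by blast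
        qed
        have Y: "?m ` Y = insert (?m \<alpha>) (?m ` S \<alpha>)"
          unfolding S using \<alpha>(1) by blast
        show ?thesis
        proof
          fix z assume "z \<in> H b \<inter> Idl (?m ` Y)"
          then have zH: "z \<in> H b" and "z \<in> Idl (insert (?m \<alpha>) (?m ` S \<alpha>))"
            unfolding Y by auto
          then obtain c w where cw: "c \<in> carrier R" "w \<in> W \<alpha>" "z = c \<otimes> ?m \<alpha> \<oplus> w"
            using genideal_insertE[of "?m \<alpha>" "?m ` S \<alpha>" z] img[of Y] unfolding Y W_def by blast
          have wc: "w \<in> carrier R" and zc: "z \<in> carrier R"
            using ideal.Icarr[OF Wid cw(2)] ideal.Icarr[OF Hid zH] .
          have "c \<otimes> ?m \<alpha> = z \<oplus> (\<zero> \<ominus> w)"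
            unfolding cw(3) using cw(1) wc mc[of \<alpha>] by algebra
          moreover have "\<zero> \<ominus> w \<in> W \<alpha>"
            by (intro ideal_minus_closed Wid ideal_zero_closed cw)
          ultimately have "c \<in> L \<alpha>"
            unfolding L_def sum_ideals_iff using cw(1) zH \<alpha>e(2) by blast
          then obtain f where f: "f \<in> A" "f \<le> \<alpha>" "c \<in> L f"
            using A(3)[OF \<alpha>e(1)] by blast
          let ?\<gamma> = "\<alpha> - f"
          have ga: "?\<gamma> \<in> exponents p" "?\<gamma> + f = \<alpha>"
            using f \<alpha>e by (auto intro: exponents_diff diff_add_exponent)
          have dg: "?d ?\<gamma> + ?d f = b"
            using multideg_add[of \<delta> p ?\<gamma> f] ga(2) \<alpha>e(2) by simp
          obtain h v where hv: "h \<in> H (?d f)" "v \<in> W f" "c \<otimes> ?m f = h \<oplus> v"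
            using f(3) unfolding L_def sum_ideals_iff by blast
          have hc: "h \<in> carrier R" "v \<in> carrier R"
            using ideal.Icarr[OF Hid hv(1)] ideal.Icarr[OF Wid hv(2)] .
          \<comment> \<open>The coefficient \<open>c\<close> already occurs at \<open>f\<close>, so
            \<open>?m ?\<gamma> \<otimes> h\<close> has an expression with the same leading term as
            \<open>z\<close>. The difference \<open>z'\<close> uses only smaller monomials and still
            lies in \<open>H b\<close>, so the induction hypothesis applies to it.\<close>
          define z' where "z' = ?m ?\<gamma> \<otimes> v \<oplus> w"
          have "c \<otimes> ?m \<alpha> = c \<otimes> (?m ?\<gamma> \<otimes> ?m f)"
            using mon_add[of p g ?\<gamma> f, OF g] ga(2) by simp
          also have "\<dots> = ?m ?\<gamma> \<otimes> (c \<otimes> ?m f)"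
            using cw(1) mc by (simp add: m_lcomm)
          also have "\<dots> = ?m ?\<gamma> \<otimes> h \<oplus> ?m ?\<gamma> \<otimes> v"
            unfolding hv(3) using hc mc by (simp add: r_distr)
          finally have zeq: "z = ?m ?\<gamma> \<otimes> h \<oplus> z'"
            unfolding cw(3) z'_def using hc wc mc by (simp add: a_assoc)
          have z'W: "z' \<in> W \<alpha>"
            unfolding z'_def using Wmul[OF ga(1) hv(2)] ga(2) by (intro ideal_add_closed Wid cw) simp
          have hb: "?m ?\<gamma> \<otimes> h \<in> H b"
            using Hmul[OF ga(1) hv(1)] dg by simp
          then have "z' \<in> H b"
            using ideal_add_cancel[OF Hid, of "?m ?\<gamma> \<otimes> h" z' b] zH zeq ideal.Icarr[OF Wid z'W] by simp
          then have "z' \<in> D"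
            using IH z'W unfolding W_def S by blast
          moreover have "?m ?\<gamma> \<otimes> h \<in> D"
            using gen f(1) ga(1) hv(1) dg by blast
          ultimately show "z \<in> D"
            unfolding zeq by (intro ideal_add_closed D)
        qed
      qed
    qed
    have "H b \<inter> Idl (?m ` ?B) \<subseteq> D"
      by (rule main[OF finite_multideg]) auto
    then show ?thesis using Hsub[of b] by blast
  qed
  then show ?thesis
    using A(1) by (intro exI[of _ "?d ` A"]) blast
qed

end

section \<open>Products of powers of ideals\<close>

definition unit_exp :: "nat \<Rightarrow> nat \<Rightarrow> nat" where
  "unit_exp i = (\<lambda>k. if k = i then 1 else 0)"

context cring
begin

lemma ideal_prod_swap:
  assumes "ideal A R" "ideal B R" "ideal C R" "ideal D R"
  shows "(A \<cdot> B) \<cdot> (C \<cdot> D) = (A \<cdot> C) \<cdot> (B \<cdot> D)"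
proof -
  have "(A \<cdot> B) \<cdot> (C \<cdot> D) = A \<cdot> ((B \<cdot> C) \<cdot> D)"
    using assms by (simp add: ideal_prod_assoc ideal_prod_is_ideal)
  also have "\<dots> = A \<cdot> ((C \<cdot> B) \<cdot> D)"
    by (simp only: ideal_prod_commute[OF assms(2,3)])
  also have "\<dots> = (A \<cdot> C) \<cdot> (B \<cdot> D)"
    using assms by (simp add: ideal_prod_assoc ideal_prod_is_ideal)
  finally show ?thesis .
qed

lemma genideal_mult_mem:
  assumes "ideal D R" "A \<subseteq> carrier R" "B \<subseteq> carrier R" "\<And>a b. a \<in> A \<Longrightarrow> b \<in> B \<Longrightarrow> a \<otimes> b \<in> D"
    "x \<in> Idl A" "y \<in> Idl B"
  shows "x \<otimes> y \<in> D"
proof -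
  have "Idl A \<subseteq> {x \<in> carrier R. x \<otimes> b \<in> D}" if "b \<in> B" for b
    using assms(2-4) that by (intro genideal_minimal preimage_mult_ideal assms(1)) auto
  then have xb: "x \<otimes> b \<in> D" if "b \<in> B" for b
    using that assms(5) by auto
  have x: "x \<in> carrier R"
    using assms(5) ideal.Icarr[OF genideal_ideal[OF assms(2)]] by auto
  have "Idl B \<subseteq> {y \<in> carrier R. y \<otimes> x \<in> D}"
    using assms(3) x xb
    by (intro genideal_minimal preimage_mult_ideal assms(1)) (auto simp: m_comm[OF _ x])
  then have "y \<in> carrier R" "y \<otimes> x \<in> D" using assms(6) by auto
  then show ?thesis using x by (simp add: m_comm)
qed

lemma multi_pow_ideal:
  "(\<And>i. i < s \<Longrightarrow> ideal (J i) R) \<Longrightarrow> ideal (ideal_multi_pow R J b s) R"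
  by (induction s) (auto intro!: ideal_prod_is_ideal oneideal ideal_pow_ideal)

lemma multi_pow_cong:
  "(\<And>i. i < s \<Longrightarrow> J i = J' i) \<Longrightarrow> (\<And>i. i < s \<Longrightarrow> b i = b' i) \<Longrightarrow>
    ideal_multi_pow R J b s = ideal_multi_pow R J' b' s"
  by (induction s) auto

lemma multi_pow_add:
  "(\<And>i. i < s \<Longrightarrow> ideal (J i) R) \<Longrightarrow>
    ideal_multi_pow R J (a + b) s = ideal_multi_pow R J a s \<cdot> ideal_multi_pow R J b s"
proof (induction s)
  case 0
  show ?case by (simp add: ideal_prod_one oneideal)
next
  case (Suc s)
  have IH: "ideal_multi_pow R J (a + b) s = ideal_multi_pow R J a s \<cdot> ideal_multi_pow R J b s"
    using Suc.prems by (intro Suc.IH) simp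
  have id: "ideal (ideal_multi_pow R J a s) R" "ideal (ideal_multi_pow R J b s) R" "ideal (J s) R"
    using Suc.prems by (auto intro: multi_pow_ideal)
  have "ideal_multi_pow R J (a + b) (Suc s) =
      (ideal_multi_pow R J a s \<cdot> ideal_multi_pow R J b s) \<cdot> ideal_pow R (J s) (a s + b s)"
    unfolding ideal_multi_pow.simps IH by simp
  also have "\<dots> = (ideal_multi_pow R J a s \<cdot> ideal_pow R (J s) (a s)) \<cdot>
      (ideal_multi_pow R J b s \<cdot> ideal_pow R (J s) (b s))"
    using id by (simp add: ideal_pow_add ideal_prod_swap ideal_pow_ideal)
  finally show ?case
    by (simp only: ideal_multi_pow.simps)
qed

lemma multi_pow_antimono:
  assumes "\<And>i. i < s \<Longrightarrow> ideal (J i) R" "\<And>i. i < s \<Longrightarrow> a i \<le> b i"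
  shows "ideal_multi_pow R J b s \<subseteq> ideal_multi_pow R J a s"
proof -
  have "ideal_multi_pow R J b s = ideal_multi_pow R J (a + (\<lambda>i. b i - a i)) s"
    using assms(2) by (intro multi_pow_cong) auto
  also have "\<dots> = ideal_multi_pow R J a s \<cdot> ideal_multi_pow R J (\<lambda>i. b i - a i) s"
    by (rule multi_pow_add[of s J, OF assms(1)])
  also have "\<dots> \<subseteq> ideal_multi_pow R J a s"
    using ideal_prod_inter[OF multi_pow_ideal[of s J, OF assms(1)] multi_pow_ideal[of s J, OF assms(1)]]
    by blast
  finally show ?thesis .
qed

lemma multi_pow_zero: "(\<And>i. i < s \<Longrightarrow> b i = 0) \<Longrightarrow> ideal_multi_pow R J b s = carrier R"
  by (induction s) (simp_all add: ideal_prod_one oneideal)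

lemma multi_pow_unit:
  "(\<And>i. i < s \<Longrightarrow> ideal (J i) R) \<Longrightarrow> i < s \<Longrightarrow> J i \<subseteq> ideal_multi_pow R J (unit_exp i) s"
proof (induction s)
  case (Suc s)
  have id: "ideal (ideal_multi_pow R J (unit_exp i) s) R" "ideal (J s) R"
    using Suc.prems by (auto intro: multi_pow_ideal)
  show ?case
  proof (cases "i = s")
    case True
    have "ideal_multi_pow R J (unit_exp i) s = carrier R"
      using True by (intro multi_pow_zero) (simp add: unit_exp_def)
    then show ?thesis
      using id True by (simp add: unit_exp_def ideal_prod_commute[OF oneideal] ideal_prod_one
          ideal_prod_is_ideal oneideal)
  next
    case False
    then have "J i \<subseteq> ideal_multi_pow R J (unit_exp i) s"
      using Suc.prems by (intro Suc.IH) auto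
    then show ?thesis
      using id False by (simp add: unit_exp_def ideal_prod_one)
  qed
qed simp

lemma multi_pow_single_subset:
  assumes "\<And>i. i < Suc s \<Longrightarrow> ideal (J i) R"
  shows "ideal_multi_pow R J b (Suc s) \<subseteq> ideal_pow R (J s) (b s)"
  using ideal_prod_inter[OF multi_pow_ideal ideal_pow_ideal, of s J "J s" b "b s"] assms by simp

lemma pow_mem_multi_pow:
  assumes "\<And>i. i < s \<Longrightarrow> ideal (J i) R" "i < s" "x \<in> J i"
  shows "x [^] n \<in> ideal_multi_pow R J (\<lambda>k. if k = i then n else 0) s"
proof (induction n)
  case 0
  show ?case
    by (subst multi_pow_zero) simp_all
next
  case (Suc n)
  have "(\<lambda>k. if k = i then Suc n else 0) = (\<lambda>k. if k = i then n else 0) + unit_exp i"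
    by (auto simp: unit_exp_def)
  moreover have "x \<in> ideal_multi_pow R J (unit_exp i) s"
    using multi_pow_unit[of s J i] assms by blast
  ultimately show ?case
    using Suc
    by (simp only: multi_pow_add[of s J, OF assms(1)] nat_pow_Suc) (rule ideal_prod.prod)
qed

lemma mon_mem_multi_pow:
  assumes "\<And>i. i < s \<Longrightarrow> ideal (J i) R" "\<And>j. j < p \<Longrightarrow> \<delta> j < s" "\<And>j. j < p \<Longrightarrow> g j \<in> J (\<delta> j)"
  shows "mon g p \<alpha> \<in> ideal_multi_pow R J (multideg \<delta> p \<alpha>) s"
  using assms(2,3)
proof (induction p)
  case 0
  show ?case by (subst multi_pow_zero) (simp_all add: multideg_def)
next
  case (Suc p)
  have "multideg \<delta> (Suc p) \<alpha> = multideg \<delta> p \<alpha> + (\<lambda>k. if k = \<delta> p then \<alpha> p else 0)"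
    by (auto simp: multideg_def)
  moreover have "mon g p \<alpha> \<in> ideal_multi_pow R J (multideg \<delta> p \<alpha>) s"
    using Suc by simp
  moreover have "g p [^] \<alpha> p \<in> ideal_multi_pow R J (\<lambda>k. if k = \<delta> p then \<alpha> p else 0) s"
    by (intro pow_mem_multi_pow assms(1) Suc.prems) auto
  ultimately show ?case
    by (simp only: multi_pow_add[of s J, OF assms(1)] mon.simps) (rule ideal_prod.prod)
qed

lemma mon_unit_exp:
  assumes "\<And>j. j < p \<Longrightarrow> g j \<in> carrier R" "j < p"
  shows "mon g p (unit_exp j) = g j"
proof -
  have one: "mon g q (unit_exp j) = \<one>" if "q \<le> j" for q
    using that
  proof (induction q)
    case (Suc q)
    then show ?case by (simp add: unit_exp_def)
  qed simp
  show ?thesis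
    using assms
  proof (induction p)
    case (Suc p)
    show ?case
    proof (cases "j = p")
      case True
      then show ?thesis using one[of p] Suc.prems by (simp add: unit_exp_def)
    next
      case False
      then show ?thesis using Suc by (simp add: unit_exp_def)
    qed
  qed simp
qed

text \<open>Together with \<open>mon_mem_multi_pow\<close> this describes the component of degree
  \<open>b\<close> of the Rees algebra by monomials. The spans \<open>S\<close> multiply into each
  other with degrees added, so it is enough to place each \<open>J i\<close> in degree
  \<open>unit_exp i\<close>.\<close>

lemma multi_pow_subset_span:
  assumes J: "\<And>i. i < s \<Longrightarrow> ideal (J i) R"
    and gJ: "\<And>j. j < p \<Longrightarrow> g j \<in> carrier R"
    and gen: "\<And>i. i < s \<Longrightarrow> J i = Idl {g j | j. j < p \<and> \<delta> j = i}"
    and b: "b \<in> exponents s"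
  shows "ideal_multi_pow R J b s \<subseteq> Idl (mon g p ` {\<alpha> \<in> exponents p. multideg \<delta> p \<alpha> = b})"
proof -
  define S where "S b = Idl (mon g p ` {\<alpha> \<in> exponents p. multideg \<delta> p \<alpha> = b})" for b
  have img: "mon g p ` A \<subseteq> carrier R" for A
    using mon_closed[of p g, OF gJ] by auto
  have Sid: "ideal (S b) R" for b
    unfolding S_def by (rule genideal_ideal[OF img])
  have mem: "mon g p \<alpha> \<in> S b" if "\<alpha> \<in> exponents p" "multideg \<delta> p \<alpha> = b" for \<alpha> b
    unfolding S_def using that by (intro subsetD[OF genideal_self[OF img]]) auto
  have Smul: "A \<cdot> B \<subseteq> S (a + b)" if "A \<subseteq> S a" "B \<subseteq> S b" for A B a b
  proof (rule ideal_prod_least[OF Sid])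
    fix x y assume "x \<in> A" "y \<in> B"
    then have xy: "x \<in> S a" "y \<in> S b" using that by auto
    show "x \<otimes> y \<in> S (a + b)"
    proof (rule genideal_mult_mem[OF Sid img img _ xy[unfolded S_def]])
      fix u v assume "u \<in> mon g p ` {\<alpha> \<in> exponents p. multideg \<delta> p \<alpha> = a}"
        "v \<in> mon g p ` {\<alpha> \<in> exponents p. multideg \<delta> p \<alpha> = b}"
      then obtain \<alpha> \<beta> where "\<alpha> \<in> exponents p" "multideg \<delta> p \<alpha> = a" "u = mon g p \<alpha>"
          "\<beta> \<in> exponents p" "multideg \<delta> p \<beta> = b" "v = mon g p \<beta>"
        by blast
      then show "u \<otimes> v \<in> S (a + b)"
        using mem[of "\<alpha> + \<beta>" "a + b"] mon_add[of p g \<alpha> \<beta>, OF gJ]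
        by (simp only: exponents_add multideg_add)
    qed
  qed
  have S0: "carrier R \<subseteq> S 0"
  proof -
    have "mon g q 0 = \<one>" for q
      by (induction q) simp_all
    moreover have "multideg \<delta> p 0 = 0" "0 \<in> exponents p"
      by (auto simp: multideg_def exponents_def)
    ultimately have "\<one> \<in> S 0"
      using mem[of 0 0] by simp
    then show ?thesis
      using ideal.one_imp_carrier[OF Sid] by blast
  qed
  have SJ: "J i \<subseteq> S (unit_exp i)" if "i < s" for i
    unfolding gen[OF that]
  proof (rule genideal_minimal[OF Sid], rule subsetI)
    fix x assume "x \<in> {g j | j. j < p \<and> \<delta> j = i}"
    then obtain j where j: "j < p" "\<delta> j = i" "x = g j" by blast
    have "multideg \<delta> p (unit_exp j) = unit_exp i"
    proof
      fix k
      have "(\<Sum>l<p. if \<delta> l = k then unit_exp j l else 0) = (\<Sum>l<p. if l = j then unit_exp i k else 0)"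
        by (rule sum.cong) (auto simp: unit_exp_def j)
      then show "multideg \<delta> p (unit_exp j) k = unit_exp i k"
        using j(1) by (simp add: multideg_def)
    qed
    moreover have "unit_exp j \<in> exponents p"
      using j(1) by (auto simp: exponents_def unit_exp_def)
    ultimately show "x \<in> S (unit_exp i)"
      using mem[of "unit_exp j" "unit_exp i"] mon_unit_exp[of p g j, OF gJ j(1)] j(3) by simp
  qed
  have Spow: "ideal_pow R (J i) n \<subseteq> S (\<lambda>k. if k = i then n else 0)" if "i < s" for i n
  proof (induction n)
    case 0
    then show ?case using S0 by (simp add: zero_fun_def)
  next
    case (Suc n)
    have "(\<lambda>k. if k = i then Suc n else 0) = (\<lambda>k. if k = i then n else 0) + unit_exp i"
      by (auto simp: unit_exp_def)
    then show ?case
      using Smul[OF Suc SJ[OF that]] by (simp only: ideal_pow.simps)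
  qed
  \<comment> \<open>Only the first \<open>t\<close> factors are present, so the degree is cut off
    there; at \<open>t = s\<close> the cut-off returns \<open>b\<close> because
    \<open>b \<in> exponents s\<close>.\<close>
  have "ideal_multi_pow R J b t \<subseteq> S (\<lambda>k. if k < t then b k else 0)" if "t \<le> s" for t
    using that
  proof (induction t)
    case 0
    then show ?case using S0 by (simp add: zero_fun_def)
  next
    case (Suc t)
    have "(\<lambda>k. if k < Suc t then b k else 0) = (\<lambda>k. if k < t then b k else 0) + (\<lambda>k. if k = t then b t else 0)"
      by (auto simp: less_Suc_eq)
    moreover have "ideal_multi_pow R J b t \<subseteq> S (\<lambda>k. if k < t then b k else 0)"
      using Suc by simp
    ultimately show ?case
      using Smul[OF _ Spow[of t "b t"]] Suc.prems by (simp only: ideal_multi_pow.simps Suc_le_lessD)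
  qed
  from this[of s] have "ideal_multi_pow R J b s \<subseteq> S (\<lambda>k. if k < s then b k else 0)"
    by simp
  moreover have "(\<lambda>k. if k < s then b k else 0) = b"
    using b by (auto simp: exponents_def)
  ultimately show ?thesis
    by (simp only: S_def)
qed

text \<open>This is A : M^\<infinity>. For an ideal \<open>A\<close> it is the preimage in
  \<open>R\<close> of the elements of R/A annihilated by a power of \<open>M\<close>.\<close>

definition saturation :: "'a set \<Rightarrow> 'a set \<Rightarrow> 'a set" where
  "saturation M A = {z \<in> carrier R. \<exists>e. \<forall>a\<in>ideal_pow R M e. a \<otimes> z \<in> A}"

lemma saturation_mono: "A \<subseteq> B \<Longrightarrow> saturation M A \<subseteq> saturation M B"
  unfolding saturation_def by blast

lemma saturation_mult:
  assumes "ideal M R" "z \<in> saturation M A" "x \<in> carrier R" "\<And>a. a \<in> A \<Longrightarrow> x \<otimes> a \<in> B"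
  shows "x \<otimes> z \<in> saturation M B"
proof -
  obtain e where e: "z \<in> carrier R" "\<forall>a\<in>ideal_pow R M e. a \<otimes> z \<in> A"
    using assms(2) unfolding saturation_def by blast
  have "a \<otimes> (x \<otimes> z) \<in> B" if a: "a \<in> ideal_pow R M e" for a
  proof -
    have "a \<in> carrier R"
      using ideal.Icarr[OF ideal_pow_ideal[OF assms(1)] a] .
    then have "a \<otimes> (x \<otimes> z) = x \<otimes> (a \<otimes> z)"
      using e(1) assms(3) by (simp add: m_lcomm)
    then show ?thesis using assms(4) e(2) a by simp
  qed
  then show ?thesis
    using e(1) assms(3) unfolding saturation_def by blast
qed

lemma saturation_ideal:
  assumes "ideal M R" "ideal A R"
  shows "ideal (saturation M A) R"
proof (rule idealI)
  show "ring R" by (rule ring_axioms)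
  have lmult: "x \<otimes> z \<in> saturation M A" if "z \<in> saturation M A" "x \<in> carrier R" for x z
    using saturation_mult[OF assms(1) that] ideal.I_l_closed[OF assms(2)] that(2) by blast
  have carr: "z \<in> carrier R" if "z \<in> saturation M A" for z
    using that by (simp add: saturation_def)
  show "subgroup (saturation M A) (add_monoid R)"
  proof (rule add.subgroupI)
    show "saturation M A \<subseteq> carrier R" using carr by blast
    have "\<zero> \<in> saturation M A"
      unfolding saturation_def
      using ideal_zero_closed[OF assms(2)] by (auto intro!: exI[of _ 0])
    then show "saturation M A \<noteq> {}" by blast
    fix z assume z: "z \<in> saturation M A"
    have "(\<ominus> \<one>) \<otimes> z = \<ominus> z" using carr[OF z] by (simp add: l_minus)
    then show "\<ominus> z \<in> saturation M A" using lmult[OF z, of "\<ominus> \<one>"] by simp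
    fix y assume y: "y \<in> saturation M A"
    obtain e f where ef: "\<forall>a\<in>ideal_pow R M e. a \<otimes> z \<in> A" "\<forall>a\<in>ideal_pow R M f. a \<otimes> y \<in> A"
      using z y unfolding saturation_def by blast
    have "a \<otimes> (z \<oplus> y) \<in> A" if a: "a \<in> ideal_pow R M (max e f)" for a
    proof -
      have "a \<in> carrier R"
        using ideal.Icarr[OF ideal_pow_ideal[OF assms(1)] a] .
      moreover have "a \<otimes> z \<in> A" "a \<otimes> y \<in> A"
        using ef a ideal_pow_antimono[OF assms(1), of e "max e f"]
          ideal_pow_antimono[OF assms(1), of f "max e f"] by auto
      ultimately show ?thesis
        using carr[OF z] carr[OF y] ideal_add_closed[OF assms(2)] by (simp add: r_distr)
    qed
    then show "z \<oplus> y \<in> saturation M A"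
      using carr[OF z] carr[OF y] unfolding saturation_def by blast
  qed
  fix z x assume "z \<in> saturation M A" "x \<in> carrier R"
  then show "x \<otimes> z \<in> saturation M A" "z \<otimes> x \<in> saturation M A"
    using lmult carr by (auto simp: m_comm[of z x])
qed

end

context noetherian_cring
begin

text \<open>In \<open>saturation\<close> the exponent depends on the element. For finitely many
  generators of \<open>K\<close> the sum of their exponents serves all of them, and hence all of
  \<open>K\<close>.\<close>

lemma saturation_uniform:
  assumes "ideal M R" "ideal A R" "ideal K R" "K \<subseteq> saturation M A"
  shows "\<exists>e. \<forall>a\<in>ideal_pow R M e. \<forall>h\<in>K. a \<otimes> h \<in> A"
proof -
  obtain G where G: "G \<subseteq> carrier R" "finite G" "K = Idl G"
    using finetely_gen[OF assms(3)] by blast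
  have "\<forall>x\<in>G. \<exists>e. \<forall>a\<in>ideal_pow R M e. a \<otimes> x \<in> A"
    using assms(4) genideal_self[OF G(1)] unfolding G(3) saturation_def by blast
  then obtain e where e: "\<And>x a. x \<in> G \<Longrightarrow> a \<in> ideal_pow R M (e x) \<Longrightarrow> a \<otimes> x \<in> A"
    by metis
  have "a \<otimes> h \<in> A" if a: "a \<in> ideal_pow R M (sum e G)" and h: "h \<in> K" for a h
  proof -
    have ac: "a \<in> carrier R"
      using ideal.Icarr[OF ideal_pow_ideal[OF assms(1)] a] .
    have "a \<otimes> x \<in> A" if "x \<in> G" for x
    proof -
      have "e x \<le> sum e G"
        using that G(2) by (intro member_le_sum) auto
      then show ?thesis
        using e[OF that] a ideal_pow_antimono[OF assms(1)] by blast
    qed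
    then have "Idl G \<subseteq> {h \<in> carrier R. h \<otimes> a \<in> A}"
      using G(1) ac
      by (intro genideal_minimal preimage_mult_ideal assms(2)) (auto simp: m_comm[OF _ ac])
    then have "h \<in> carrier R" "h \<otimes> a \<in> A"
      using h G(3) by auto
    then show ?thesis using ac by (simp add: m_comm)
  qed
  then show ?thesis by blast
qed

lemma exists_graded_generators:
  assumes "\<And>i. i < s \<Longrightarrow> ideal (J i) R"
  shows "\<exists>p g \<delta>. (\<forall>j<p. g j \<in> carrier R \<and> \<delta> j < s) \<and>
    (\<forall>i<s. J i = Idl {g j | j. j < (p::nat) \<and> \<delta> j = (i::nat)})"
proof -
  have "\<forall>i\<in>{..<s}. \<exists>A. A \<subseteq> carrier R \<and> finite A \<and> J i = Idl A"
    using finetely_gen[OF assms] by blast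
  then obtain G where G: "\<And>i. i < s \<Longrightarrow> G i \<subseteq> carrier R" "\<And>i. i < s \<Longrightarrow> finite (G i)"
      "\<And>i. i < s \<Longrightarrow> J i = Idl (G i)"
    unfolding Ball_def lessThan_iff by metis
  \<comment> \<open>A disjoint union: a generator shared by two ideals is listed once for each,
    because its degree has to record the ideal it stands for.\<close>
  define V where "V = (SIGMA i:{..<s}. G i)"
  have "finite V" unfolding V_def using G(2) by auto
  then obtain h where h: "bij_betw h {0..<card V} V"
    using ex_bij_betw_nat_finite by blast
  have hV: "h j \<in> V" if "j < card V" for j
    using h that bij_betwE by fastforce
  have "{snd (h j) | j. j < card V \<and> fst (h j) = i} = G i" if "i < s" for i
  proof (intro equalityI subsetI)
    fix x assume "x \<in> {snd (h j) | j. j < card V \<and> fst (h j) = i}"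
    then show "x \<in> G i" using hV unfolding V_def by fastforce
  next
    fix x assume "x \<in> G i"
    then have "(i, x) \<in> h ` {0..<card V}"
      using that h unfolding bij_betw_def V_def by auto
    then obtain j where "j < card V" "h j = (i, x)" by auto
    then show "x \<in> {snd (h j) | j. j < card V \<and> fst (h j) = i}"
      by (metis (mono_tags, lifting) fst_conv mem_Collect_eq snd_conv)
  qed
  then have "\<forall>i<s. J i = Idl {snd (h j) | j. j < card V \<and> fst (h j) = i}"
    using G(3) by simp
  moreover have "\<forall>j<card V. snd (h j) \<in> carrier R \<and> fst (h j) < s"
    using hV G(1) unfolding V_def by fastforce
  ultimately show ?thesis
    by (intro exI[of _ "card V"] exI[of _ "\<lambda>j. snd (h j)"] exI[of _ "\<lambda>j. fst (h j)"] conjI)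
qed

end

section \<open>Uniform Artin-Rees\<close>

context noetherian_cring
begin

text \<open>For the ideals \<open>J 0, \<dots>, J (r - 1)\<close> and \<open>M = J r\<close>: the finitely many generators of the graded
  ideal with components \<open>J\<^bsup>b\<^esup> \<inter> saturation M (J\<^bsup>b + e\<^esup>)\<close>, where \<open>e\<close> is the \<open>i\<close>-th unit vector, are
  moved into \<open>J\<^bsup>b + e\<^esup>\<close> by a fixed power of \<open>M\<close>.\<close>

lemma uniform_artin_rees:
  assumes J: "\<And>k. k < Suc r \<Longrightarrow> ideal (J k) R" and i: "i < r"
  shows "\<exists>c. \<forall>b\<in>exponents (Suc r). c \<le> b r \<longrightarrow>
    ideal_multi_pow R J b (Suc r) \<inter> saturation (J r) (ideal_multi_pow R J (b + unit_exp i) r) \<subseteq>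
    ideal_multi_pow R J ((b + unit_exp i)(r := b r - c)) (Suc r)"
proof -
  let ?T = "\<lambda>b. ideal_multi_pow R J b (Suc r)" and ?P = "\<lambda>b. ideal_multi_pow R J b r"
  let ?M = "J r" and ?e = "unit_exp i"
  have Jr: "\<And>k. k < r \<Longrightarrow> ideal (J k) R" and M: "ideal ?M R" using J by auto
  have Tid: "ideal (?T b) R" and Pid: "ideal (?P b) R" for b
    using multi_pow_ideal[of _ J] J by (blast, auto)
  have Tadd: "?T (a + b) = ?T a \<cdot> ?T b" and Padd: "?P (a + b) = ?P a \<cdot> ?P b" for a b
    by (rule multi_pow_add[of _ J], use J in simp)+
  have TP: "?T b \<subseteq> ?P b" for b
    using ideal_prod_inter[OF Pid[of b] ideal_pow_ideal[OF M, of "b r"]] by auto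
  have "\<exists>p g \<delta>. (\<forall>j<p. g j \<in> carrier R \<and> \<delta> j < Suc r) \<and>
      (\<forall>k<Suc r. J k = Idl {g j | j. j < (p::nat) \<and> \<delta> j = (k::nat)})"
    by (rule exists_graded_generators[of "Suc r" J, OF J])
  then obtain p g \<delta> where *: "(\<forall>j<p. g j \<in> carrier R \<and> \<delta> j < Suc r) \<and>
      (\<forall>k<Suc r. J k = Idl {g j | j. j < (p::nat) \<and> \<delta> j = (k::nat)})"
    by (elim exE)
  then have gc: "\<And>j. j < p \<Longrightarrow> g j \<in> carrier R" and \<delta>: "\<And>j. j < p \<Longrightarrow> \<delta> j < Suc r"
    and gen: "\<And>k. k < Suc r \<Longrightarrow> J k = Idl {g j | j. j < p \<and> \<delta> j = k}"
    by simp_all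
  have gJ: "g j \<in> J (\<delta> j)" if "j < p" for j
  proof -
    have "{g k | k. k < p \<and> \<delta> k = \<delta> j} \<subseteq> carrier R" using gc by auto
    then show ?thesis
      unfolding gen[OF \<delta>[OF that]] using that by (intro genideal_self[THEN subsetD]) auto
  qed
  have monT: "mon g p \<alpha> \<in> ?T (multideg \<delta> p \<alpha>)" for \<alpha>
    by (rule mon_mem_multi_pow[of "Suc r" J p \<delta> g, OF J \<delta> gJ])
  have degE: "multideg \<delta> p \<alpha> \<in> exponents (Suc r)" for \<alpha>
    using \<delta> unfolding multideg_def exponents_def by (fastforce intro!: sum.neutral)
  \<comment> \<open>The graded generation result speaks about all functions \<open>b\<close>.
    Monomials have degrees in \<open>exponents (Suc r)\<close> only, so elsewhere their span is zero
    and \<open>H\<close> has to be zero. The saturation is that of \<open>?P (b + ?e)\<close>, which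
    omits the power of \<open>?M\<close>.\<close>
  define H where "H b = (if b \<in> exponents (Suc r) then ?T b \<inter> saturation ?M (?P (b + ?e)) else {\<zero>})" for b
  have Hid: "ideal (H b) R" for b
    unfolding H_def by (simp only: split: if_split) (intro conjI impI i_intersect Tid saturation_ideal M Pid zeroideal)
  have "\<exists>E. finite E \<and> (\<forall>b D. ideal D R \<longrightarrow>
    (\<forall>f\<in>E. \<forall>\<alpha>\<in>exponents p. \<forall>h\<in>H f. multideg \<delta> p \<alpha> + f = b \<longrightarrow> mon g p \<alpha> \<otimes> h \<in> D) \<longrightarrow> H b \<subseteq> D)"
  proof (rule graded_finite_generation)
    fix b
    have img: "mon g p ` A \<subseteq> carrier R" for A
      using mon_closed[of p g, OF gc] by auto
    show "H b \<subseteq> Idl (mon g p ` {\<alpha> \<in> exponents p. multideg \<delta> p \<alpha> = b})"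
    proof (cases "b \<in> exponents (Suc r)")
      case True
      then show ?thesis
        using multi_pow_subset_span[of "Suc r" J p g \<delta> b, OF J gc gen] unfolding H_def by auto
    next
      case False
      then show ?thesis
        using ideal_zero_closed[OF genideal_ideal[OF img]] unfolding H_def by simp
    qed
  next
    fix \<alpha> b h assume \<alpha>: "\<alpha> \<in> exponents p" and h: "h \<in> H b"
    show "mon g p \<alpha> \<otimes> h \<in> H (multideg \<delta> p \<alpha> + b)"
    proof (cases "b \<in> exponents (Suc r)")
      case True
      have hT: "h \<in> ?T b" and hS: "h \<in> saturation ?M (?P (b + ?e))"
        using h True unfolding H_def by auto
      have "mon g p \<alpha> \<otimes> h \<in> ?T (multideg \<delta> p \<alpha> + b)"
        unfolding Tadd using monT hT by (rule ideal_prod.prod)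
      moreover have "mon g p \<alpha> \<otimes> h \<in> saturation ?M (?P (multideg \<delta> p \<alpha> + b + ?e))"
      proof (rule saturation_mult[OF M hS mon_closed[of p g, OF gc]])
        fix a assume "a \<in> ?P (b + ?e)"
        then have "mon g p \<alpha> \<otimes> a \<in> ?P (multideg \<delta> p \<alpha> + (b + ?e))"
          unfolding Padd[of "multideg \<delta> p \<alpha>" "b + ?e"] using subsetD[OF TP monT]
          by (intro ideal_prod.prod)
        then show "mon g p \<alpha> \<otimes> a \<in> ?P (multideg \<delta> p \<alpha> + b + ?e)"
          by (simp only: add.assoc)
      qed
      ultimately show ?thesis
        using exponents_add[OF degE True] unfolding H_def by simp
    next
      case False
      then have "h = \<zero>" using h unfolding H_def by simp
      then have "mon g p \<alpha> \<otimes> h = \<zero>"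
        using mon_closed[of p g, OF gc] by simp
      then show ?thesis using ideal_zero_closed[OF Hid] by simp
    qed
  qed (fact gc Hid)+
  then obtain E where E: "finite E" and Egen: "\<And>b D. ideal D R \<Longrightarrow>
      (\<And>f \<alpha> h. f \<in> E \<Longrightarrow> h \<in> H f \<Longrightarrow> multideg \<delta> p \<alpha> + f = b \<Longrightarrow> mon g p \<alpha> \<otimes> h \<in> D) \<Longrightarrow> H b \<subseteq> D"
    by metis
  have "\<exists>e. \<forall>a\<in>ideal_pow R ?M e. \<forall>h\<in>H f. a \<otimes> h \<in> ?P (f + ?e)" for f
  proof (intro saturation_uniform M Pid Hid)
    show "H f \<subseteq> saturation ?M (?P (f + ?e))"
      using ideal_zero_closed[OF saturation_ideal[OF M Pid]] unfolding H_def by auto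
  qed
  then obtain e where e: "\<And>f a h. a \<in> ideal_pow R ?M (e f) \<Longrightarrow> h \<in> H f \<Longrightarrow> a \<otimes> h \<in> ?P (f + ?e)"
    by metis
  \<comment> \<open>One number that, for each generating degree \<open>f\<close>, covers both its
    degree in \<open>?M\<close> and the power of \<open>?M\<close> moving \<open>H f\<close> into
    \<open>?P (f + ?e)\<close>.\<close>
  define c where "c = (\<Sum>f\<in>E. f r + e f)"
  have cf: "f r + e f \<le> c" if "f \<in> E" for f
    unfolding c_def using that E by (intro member_le_sum[of f E "\<lambda>f. f r + e f"]) auto
  have "H b \<subseteq> ?T ((b + ?e)(r := b r - c))" if b: "b \<in> exponents (Suc r)" and cb: "c \<le> b r" for b
  proof (rule Egen[OF Tid])
    fix f \<alpha> h assume f: "f \<in> E" and h: "h \<in> H f" and df: "multideg \<delta> p \<alpha> + f = b"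
    let ?b' = "(b + ?e)(r := b r - c)"
    have dfk: "multideg \<delta> p \<alpha> k + f k = b k" for k
      using df by (auto simp: fun_eq_iff)
    \<comment> \<open>The monomial has degree \<open>b r - f r\<close> in \<open>?M\<close>. The
      part \<open>a2\<close> of size \<open>c - f r \<ge> e f\<close> is spent on moving
      \<open>h\<close> into \<open>?P (f + ?e)\<close>, a product without a power of
      \<open>?M\<close> whose degree is \<open>a3\<close>. The rest \<open>a1\<close> retains degree
      \<open>b r - c\<close> in \<open>?M\<close>.\<close>
    define a2 where "a2 = (\<lambda>k. if k = r then c - f r else 0)"
    define a1 where "a1 = (\<lambda>k. multideg \<delta> p \<alpha> k - a2 k)"
    define a3 where "a3 = (f + ?e)(r := 0)"
    have a12: "multideg \<delta> p \<alpha> = a1 + a2"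
      using dfk[of r] cb by (auto simp: a1_def a2_def fun_eq_iff)
    have a13: "a1 + a3 = ?b'"
    proof
      fix k
      show "(a1 + a3) k = ?b' k"
        using dfk[of k] dfk[of r] cf[OF f] cb i
        by (cases "k = r") (auto simp: a1_def a2_def a3_def)
    qed
    have hc: "h \<in> carrier R" using ideal.Icarr[OF Hid h] .
    have "?P (f + ?e) = ?P a3"
      unfolding a3_def by (rule multi_pow_cong) auto
    also have "\<dots> = ?T a3"
      by (simp add: a3_def ideal_prod_one[OF Pid])
    finally have PT: "?P (f + ?e) = ?T a3" .
    have "?T (multideg \<delta> p \<alpha>) \<subseteq> {x \<in> carrier R. x \<otimes> h \<in> ?T ?b'}"
      unfolding a12 Tadd
    proof (rule ideal_prod_least[OF preimage_mult_ideal[OF Tid hc]])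
      fix y w assume y: "y \<in> ?T a1" and w: "w \<in> ?T a2"
      have "w \<in> ideal_pow R ?M (c - f r)"
        using multi_pow_single_subset[of r J a2, OF J] w by (auto simp: a2_def)
      moreover have "e f \<le> c - f r"
        using cf[OF f] by linarith
      ultimately have "w \<in> ideal_pow R ?M (e f)"
        using ideal_pow_antimono[OF M, of "e f" "c - f r"] by blast
      then have "w \<otimes> h \<in> ?T a3"
        using e[OF _ h] PT by blast
      then have "y \<otimes> (w \<otimes> h) \<in> ?T ?b'"
        unfolding a13[symmetric] Tadd using y by (intro ideal_prod.prod)
      moreover have "y \<in> carrier R" "w \<in> carrier R"
        using ideal.Icarr[OF Tid y] ideal.Icarr[OF Tid w] .
      ultimately show "y \<otimes> w \<in> {x \<in> carrier R. x \<otimes> h \<in> ?T ?b'}"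
        using hc by (simp add: m_assoc)
    qed
    then show "mon g p \<alpha> \<otimes> h \<in> ?T ?b'"
      using monT by blast
  qed
  then show ?thesis
    by (intro exI[of _ c] ballI impI) (simp only: H_def if_True)
qed

lemma saturation_inter_power_subset:
  assumes I: "\<And>k. k < r \<Longrightarrow> ideal (I k) R" and M: "ideal M R"
  shows "\<exists>c. \<forall>n. saturation M (ideal_multi_pow R I n r) \<inter> ideal_pow R M (c * (\<Sum>i<r. n i)) \<subseteq>
    ideal_multi_pow R I n r"
proof -
  define J where "J = I(r := M)"
  have J: "ideal (J k) R" if "k < Suc r" for k
    using that I M by (auto simp: J_def less_Suc_eq)
  then have Jr: "\<And>k. k < r \<Longrightarrow> ideal (J k) R" by simp
  have JM: "J r = M" by (simp add: J_def)
  let ?T = "\<lambda>b. ideal_multi_pow R J b (Suc r)" and ?P = "\<lambda>b. ideal_multi_pow R J b r"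
  have IJ: "ideal_multi_pow R I n r = ?P n" for n
    by (rule multi_pow_cong) (auto simp: J_def)
  have "\<forall>i. \<exists>c. i < r \<longrightarrow> (\<forall>b\<in>exponents (Suc r). c \<le> b r \<longrightarrow>
      ?T b \<inter> saturation M (?P (b + unit_exp i)) \<subseteq> ?T ((b + unit_exp i)(r := b r - c)))"
    using uniform_artin_rees[of r J, OF J] unfolding JM by blast
  then obtain cc where cc: "\<And>i b. i < r \<Longrightarrow> b \<in> exponents (Suc r) \<Longrightarrow> cc i \<le> b r \<Longrightarrow>
      ?T b \<inter> saturation M (?P (b + unit_exp i)) \<subseteq> ?T ((b + unit_exp i)(r := b r - cc i))"
    by metis
  \<comment> \<open>A common loss for all \<open>r\<close> directions; enlarging the constant only
    weakens the inclusion.\<close>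
  define c where "c = (\<Sum>i<r. cc i)"
  have step: "?T b \<inter> saturation M (?P (b + unit_exp i)) \<subseteq> ?T ((b + unit_exp i)(r := b r - c))"
    if "i < r" "b \<in> exponents (Suc r)" "c \<le> b r" for i b
  proof -
    have "cc i \<le> c"
      unfolding c_def using that(1) by (intro member_le_sum) auto
    then have "?T ((b + unit_exp i)(r := b r - cc i)) \<subseteq> ?T ((b + unit_exp i)(r := b r - c))"
      by (intro multi_pow_antimono J) auto
    then show ?thesis
      using cc[OF that(1,2)] \<open>cc i \<le> c\<close> that(3) by (meson order_trans)
  qed
  have "z \<in> ?P n" if z: "z \<in> saturation M (?P n)" "z \<in> ideal_pow R M (c * (\<Sum>i<r. n i))" for n z
  proof -
    let ?N = "\<Sum>i<r. n i"
    \<comment> \<open>The invariant of the path: at a point \<open>a\<close> of size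
      \<open>t\<close> below \<open>n\<close>, there remain \<open>c * (?N - t)\<close> powers of
      \<open>M\<close>. The step into \<open>a\<close> may be taken because
      \<open>?P n \<subseteq> ?P a\<close> puts \<open>z\<close> into the saturation of
      \<open>?P a\<close>; at \<open>t = ?N\<close> no power of \<open>M\<close> is left.\<close>
    have path: "z \<in> ?T (a(r := c * (?N - t)))"
      if "a \<in> exponents r" "\<And>i. i < r \<Longrightarrow> a i \<le> n i" "(\<Sum>i<r. a i) = t" for a t
      using that
    proof (induction t arbitrary: a)
      case 0
      have "?P (a(r := c * ?N)) = carrier R"
        using 0 by (intro multi_pow_zero) auto
      then have "?T (a(r := c * ?N)) = ideal_pow R M (c * ?N)"
        by (simp add: JM ideal_prod_commute[OF oneideal] ideal_prod_one ideal_pow_ideal M)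
      then show ?case using z(2) by (simp only: diff_zero)
    next
      case (Suc t)
      obtain i where i: "i < r" "a i > 0"
        using Suc.prems(3) by (metis (no_types, lifting) bot_nat_0.not_eq_extremum lessThan_iff
            nat.distinct(1) sum.neutral)
      let ?a = "a(i := a i - 1)"
      have sum_a: "(\<Sum>k<r. a k) = a i + (\<Sum>k\<in>{..<r} - {i}. a k)"
        using i(1) by (intro sum.remove) auto
      have "(\<Sum>k<r. ?a k) = ?a i + (\<Sum>k\<in>{..<r} - {i}. ?a k)"
        using i(1) by (intro sum.remove) auto
      also have "(\<Sum>k\<in>{..<r} - {i}. ?a k) = (\<Sum>k\<in>{..<r} - {i}. a k)"
        by (rule sum.cong) auto
      finally have suma: "(\<Sum>k<r. ?a k) = t"
        using sum_a Suc.prems(3) i(2) by simp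
      have "?a k \<le> n k" if "k < r" for k
        using Suc.prems(2)[OF that] by auto
      moreover have "?a \<in> exponents r"
        using Suc.prems(1) i(1) by (auto simp: exponents_def)
      ultimately have IH: "z \<in> ?T (?a(r := c * (?N - t)))"
        using suma by (intro Suc.IH)
      let ?b = "?a(r := c * (?N - t))"
      have "Suc t \<le> ?N"
        unfolding Suc.prems(3)[symmetric] using Suc.prems(2) by (intro sum_mono) auto
      then obtain k where "?N = Suc t + k"
        using le_Suc_ex by blast
      then have br: "c * (?N - t) - c = c * (?N - Suc t)" "c \<le> c * (?N - t)"
        by simp_all
      have bE: "?b \<in> exponents (Suc r)"
        using Suc.prems(1) i(1) by (auto simp: exponents_def)
      have "?P (?b + unit_exp i) = ?P a"
        using i by (intro multi_pow_cong) (auto simp: unit_exp_def)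
      moreover have "?P n \<subseteq> ?P a"
        using Suc.prems(2) by (intro multi_pow_antimono Jr)
      ultimately have "z \<in> saturation M (?P (?b + unit_exp i))"
        using z(1) saturation_mono[of "?P n" "?P a" M] by auto
      then have "z \<in> ?T ((?b + unit_exp i)(r := ?b r - c))"
        using step[OF i(1) bE] IH br(2) by auto
      moreover have "(?b + unit_exp i)(r := ?b r - c) = a(r := c * (?N - Suc t))"
        using i br(1) by (auto simp: unit_exp_def fun_eq_iff)
      ultimately show ?case by (simp only:)
    qed
    \<comment> \<open>The end point of the path must vanish from \<open>r\<close> on to belong to
      \<open>exponents r\<close>; the values of \<open>n\<close> there do not affect
      \<open>?P\<close>.\<close>
    let ?n = "\<lambda>i. if i < r then n i else 0"
    have "z \<in> ?T (?n(r := c * (?N - ?N)))"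
      by (rule path) (auto simp: exponents_def)
    then have "z \<in> ?P (?n(r := 0))"
      using ideal_prod_one[OF multi_pow_ideal[of r J, OF Jr]] by simp
    also have "?P (?n(r := 0)) = ?P n"
      by (rule multi_pow_cong) auto
    finally show ?thesis .
  qed
  then show ?thesis
    unfolding IJ by (intro exI[of _ c]) blast
qed

end

section \<open>Length of the local cohomology module\<close>

context cring
begin

text \<open>The correspondence between submodules of the quotient and ideals between
  \<open>J\<close> and its saturation. The last claim recovers \<open>N\<close> from
  \<open>C\<close>, so strict inclusions of submodules give strict inclusions of ideals.\<close>

lemma submodule_H0_quot_preimage:
  assumes J: "ideal J R" and m: "ideal m R" and sub: "submodule N R (H0_quot R m J)"
  defines "C \<equiv> {a \<in> carrier R. J +> a \<in> N}"
  shows "ideal C R" "J \<subseteq> C" "C \<subseteq> saturation m J" "N = (\<lambda>a. J +> a) ` C"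
proof -
  interpret J: ideal J R by (rule J)
  have subg: "subgroup N (add_monoid (H0_quot R m J))"
    using sub by (rule submodule.axioms(1))
  have sm: "J +> (x \<otimes> a) \<in> N" if "x \<in> carrier R" "a \<in> C" for x a
    using submodule.smult_closed[OF sub that(1), of "J +> a"] that
    by (simp add: C_def H0_quot_def quot_module_def J.rcoset_mult_add)
  have N: "N \<subseteq> H0_set R m J"
    using subgroup.subset[OF subg] by (simp add: H0_quot_def)
  have zero: "J \<in> N"
    using subgroup.one_closed[OF subg] by (simp add: H0_quot_def quot_module_def)
  have add: "J +> (a \<oplus> b) \<in> N" if "a \<in> C" "b \<in> C" for a b
    using subgroup.m_closed[OF subg, of "J +> a" "J +> b"] that
    by (simp add: C_def H0_quot_def quot_module_def J.a_rcos_sum)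
  show JC: "J \<subseteq> C"
    using zero J.a_rcos_const J.Icarr by (auto simp: C_def)
  show "ideal C R"
  proof (rule idealI)
    show "ring R" by (rule ring_axioms)
    show "subgroup C (add_monoid R)"
    proof (rule add.subgroupI)
      show "C \<subseteq> carrier R" by (auto simp: C_def)
      show "C \<noteq> {}" using JC ideal_zero_closed[OF J] by blast
      fix a assume a: "a \<in> C"
      then have "(\<ominus> \<one>) \<otimes> a = \<ominus> a" by (simp add: C_def l_minus)
      then show "\<ominus> a \<in> C" using sm[of "\<ominus> \<one>" a] a by (simp add: C_def)
      fix b assume "b \<in> C"
      then show "a \<oplus> b \<in> C" using a add[of a b] by (simp add: C_def)
    qed
    fix a x assume ax: "a \<in> C" "x \<in> carrier R"
    then have "x \<otimes> a \<in> C" using sm[of x a] by (simp add: C_def)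
    moreover have "a \<otimes> x = x \<otimes> a" using ax by (simp add: C_def m_comm)
    ultimately show "x \<otimes> a \<in> C" "a \<otimes> x \<in> C" by simp_all
  qed
  show "C \<subseteq> saturation m J"
  proof
    fix z assume z: "z \<in> C"
    then have zc: "z \<in> carrier R" and "J +> z \<in> H0_set R m J"
      using N by (auto simp: C_def)
    then obtain k where k: "\<forall>a\<in>ideal_pow R m k. rcoset_mult R J (J +> a) (J +> z) = J"
      by (auto simp: H0_set_def quot_module_def)
    have "a \<otimes> z \<in> J" if a: "a \<in> ideal_pow R m k" for a
    proof -
      have ac: "a \<in> carrier R"
        using ideal.Icarr[OF ideal_pow_ideal[OF m] a] .
      then have "J +> (a \<otimes> z) = J"
        using bspec[OF k a] J.rcoset_mult_add[of a z] zc by simp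
      then show ?thesis
        using J.rcos_const_imp_mem ac zc by simp
    qed
    then show "z \<in> saturation m J"
      using zc by (auto simp: saturation_def)
  qed
  show "N = (\<lambda>a. J +> a) ` C"
  proof
    show "N \<subseteq> (\<lambda>a. J +> a) ` C"
    proof
      fix Y assume Y: "Y \<in> N"
      then have "Y \<in> a_rcosets J"
        using N by (auto simp: H0_set_def quot_module_def)
      then obtain a where "a \<in> carrier R" "Y = J +> a"
        by (auto simp: A_RCOSETS_def')
      then show "Y \<in> (\<lambda>a. J +> a) ` C" using Y by (auto simp: C_def)
    qed
  qed (auto simp: C_def)
qed

text \<open>With S the saturation of \<open>J\<close>, the module S/J is a quotient of S/(S \<inter>
  Q), which embeds into R/Q. On chains this means adding \<open>Q\<close> to the preimages.\<close>

lemma module_length_H0_quot_le: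
  assumes J: "ideal J R" and m: "ideal m R" and Q: "ideal Q R"
    and len: "length_le Q (carrier R) N" and inter: "saturation m J \<inter> Q \<subseteq> J"
  shows "\<exists>l. module_length R (H0_quot R m J) = enat l \<and> l \<le> N"
proof -
  have "n \<le> N" if c: "\<forall>i\<le>n. submodule (c i) R (H0_quot R m J)" "\<forall>i<n. c i \<subset> c (Suc i)" for n c
  proof -
    define C where "C i = {a \<in> carrier R. J +> a \<in> c i}" for i
    have C: "ideal (C i) R" "J \<subseteq> C i" "C i \<subseteq> saturation m J" "c i = (\<lambda>a. J +> a) ` C i"
      if "i \<le> n" for i
      using submodule_H0_quot_preimage[OF J m c(1)[rule_format, OF that]] unfolding C_def by auto
    have mono: "C i \<subseteq> C (Suc i)" if "i < n" for i
      using c(2) that unfolding C_def by blast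
    have strict: "C i \<noteq> C (Suc i)" if "i < n" for i
      using C(4)[of i] C(4)[of "Suc i"] c(2) that by (metis Suc_leI less_imp_le psubset_eq)
    have "card {i. i < n \<and> C i <+> Q \<noteq> C (Suc i) <+> Q} \<le> N"
    proof (rule length_leD[OF len])
      fix i assume i: "i \<le> n"
      show "ideal (C i <+> Q) R" by (intro add_ideals C Q i)
      then show "C i <+> Q \<subseteq> carrier R" by (rule ideal_subset_carrier)
      show "Q \<subseteq> C i <+> Q" by (intro subset_sum_ideals C Q i)
    next
      fix i assume i: "i < n"
      show "C i <+> Q \<subseteq> C (Suc i) <+> Q"
        using mono[OF i] unfolding subset_iff sum_ideals_iff by blast
    qed
    moreover have "C i <+> Q \<noteq> C (Suc i) <+> Q" if i: "i < n" for i
    proof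
      have i': "i \<le> n" "Suc i \<le> n" using i by auto
      assume eq: "C i <+> Q = C (Suc i) <+> Q"
      \<comment> \<open>Every preimage meets \<open>Q\<close> inside \<open>J\<close>, so all
        members of the chain have the same intersection with \<open>Q\<close>. By the modular law,
        equal sums with \<open>Q\<close> would force equal members.\<close>
      have "C (Suc i) \<inter> Q \<subseteq> C i \<inter> Q"
        using C(3)[OF i'(2)] C(2)[OF i'(1)] inter by blast
      then have "C i = C (Suc i)"
        using modular_eq[OF Q C(1)[OF i'(1)] C(1)[OF i'(2)] mono[OF i]] eq mono[OF i] by blast
      then show False using strict[OF i] by simp
    qed
    then have "{i. i < n \<and> C i <+> Q \<noteq> C (Suc i) <+> Q} = {..<n}"
      by auto
    ultimately show ?thesis by simp
  qed
  then have "module_length R (H0_quot R m J) \<le> enat N"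
    unfolding module_length_def by (intro Sup_least) auto
  then show ?thesis
    by (metis enat_ile enat_ord_simps(1))
qed

end

section \<open>Polynomial functions\<close>

text \<open>Only the polynomial half of \<open>numerical_poly\<close>; being integer valued is
  checked separately for the final bound.\<close>

definition is_mpoly_fun :: "nat \<Rightarrow> nat \<Rightarrow> ((nat \<Rightarrow> int) \<Rightarrow> rat) \<Rightarrow> bool" where
  "is_mpoly_fun r d F \<longleftrightarrow> (\<exists>c. \<forall>x. F x = mpoly_fun r d c x)"

lemma finite_exps: "finite (exps r d)"
proof (rule finite_subset)
  show "finite {e :: nat \<Rightarrow> nat. \<forall>i. (i \<in> {..<r} \<longrightarrow> e i \<in> {..d}) \<and> (i \<notin> {..<r} \<longrightarrow> e i = 0)}"
    by (intro finite_set_of_finite_funs) auto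
  have "e i \<le> d" if "e \<in> exps r d" "i < r" for e i
    using that member_le_sum[of i "{..<r}" e] unfolding exps_def by auto
  then show "exps r d \<subseteq> {e. \<forall>i. (i \<in> {..<r} \<longrightarrow> e i \<in> {..d}) \<and> (i \<notin> {..<r} \<longrightarrow> e i = 0)}"
    by (auto simp: exps_def)
qed

lemma is_mpoly_fun_const: "is_mpoly_fun r 0 (\<lambda>_. q)"
proof -
  have "exps r 0 = {\<lambda>_. 0}"
    by (auto simp: exps_def fun_eq_iff) (metis lessThan_iff not_le)
  then show ?thesis
    unfolding is_mpoly_fun_def mpoly_fun_def by (intro exI[of _ "\<lambda>_. q"]) simp
qed

lemma is_mpoly_fun_add:
  assumes "is_mpoly_fun r d F" "is_mpoly_fun r d G"
  shows "is_mpoly_fun r d (\<lambda>x. F x + G x)"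
proof -
  obtain c c' where "\<And>x. F x = mpoly_fun r d c x" "\<And>x. G x = mpoly_fun r d c' x"
    using assms unfolding is_mpoly_fun_def by blast
  then show ?thesis
    unfolding is_mpoly_fun_def mpoly_fun_def
    by (intro exI[of _ "\<lambda>e. c e + c' e"]) (simp add: sum.distrib distrib_right)
qed

lemma is_mpoly_fun_smult:
  assumes "is_mpoly_fun r d F"
  shows "is_mpoly_fun r d (\<lambda>x. q * F x)"
proof -
  obtain c where "\<And>x. F x = mpoly_fun r d c x"
    using assms unfolding is_mpoly_fun_def by blast
  then show ?thesis
    unfolding is_mpoly_fun_def mpoly_fun_def
    by (intro exI[of _ "\<lambda>e. q * c e"]) (simp add: sum_distrib_left mult.assoc)
qed

lemma is_mpoly_fun_Suc:
  assumes "is_mpoly_fun r d F"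
  shows "is_mpoly_fun r (Suc d) F"
proof -
  obtain c where c: "\<And>x. F x = mpoly_fun r d c x"
    using assms unfolding is_mpoly_fun_def by blast
  have "F x = mpoly_fun r (Suc d) (\<lambda>e. if e \<in> exps r d then c e else 0) x" for x
    unfolding c mpoly_fun_def
    by (rule sum.mono_neutral_cong_left) (auto simp: finite_exps, auto simp: exps_def)
  then show ?thesis unfolding is_mpoly_fun_def by blast
qed

lemma is_mpoly_fun_mult_var:
  assumes "is_mpoly_fun r d F" "i < r"
  shows "is_mpoly_fun r (Suc d) (\<lambda>x. of_int (x i) * F x)"
proof -
  obtain c where c: "\<And>x. F x = mpoly_fun r d c x"
    using assms unfolding is_mpoly_fun_def by blast
  let ?up = "\<lambda>e :: nat \<Rightarrow> nat. e(i := Suc (e i))"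
  \<comment> \<open>Coefficients are shifted by one in direction \<open>i\<close>; the value 0
    belongs to the monomials not divisible by the \<open>i\<close>-th variable.\<close>
  let ?c = "\<lambda>e :: nat \<Rightarrow> nat. if e i = 0 then 0 else c (e(i := e i - 1))"
  have sum_up: "(\<Sum>k<r. ?up e k) = Suc (\<Sum>k<r. e k)" for e
    using assms(2) by (simp add: sum.remove[of "{..<r}" i])
  have prod_up: "(\<Prod>k<r. of_int (x k) ^ ?up e k) = of_int (x i) * (\<Prod>k<r. (of_int (x k) :: rat) ^ e k)"
    for e and x :: "nat \<Rightarrow> int"
    using assms(2) by (simp add: prod.remove[of "{..<r}" i])
  have inj: "inj_on ?up (exps r d)"
  proof (rule inj_onI)
    fix e e' :: "nat \<Rightarrow> nat" assume eq: "?up e = ?up e'"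
    show "e = e'"
    proof
      fix k show "e k = e' k"
        using fun_cong[OF eq, of k] by (cases "k = i") auto
    qed
  qed
  have up_sub: "?up ` exps r d \<subseteq> exps r (Suc d)"
    using assms(2) sum_up by (auto simp: exps_def)
  have rest: "?c e = 0" if "e \<in> exps r (Suc d) - ?up ` exps r d" for e
  proof (rule ccontr)
    assume "?c e \<noteq> 0"
    then have ei: "e i > 0" by (cases "e i = 0") simp_all
    let ?e = "e(i := e i - 1)"
    have e: "?up ?e = e" using ei by (auto simp: fun_eq_iff)
    have "(\<Sum>k<r. ?e k) \<le> d"
      using sum_up[of ?e] that unfolding e exps_def by auto
    then have "?e \<in> exps r d"
      using that assms(2) by (auto simp: exps_def)
    then have "?up ?e \<in> ?up ` exps r d" by (rule imageI)
    then show False using that e by simp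
  qed
  have "of_int (x i) * F x = mpoly_fun r (Suc d) ?c x" for x
  proof -
    have "of_int (x i) * F x = (\<Sum>e\<in>exps r d. c e * (\<Prod>k<r. of_int (x k) ^ ?up e k))"
      unfolding c mpoly_fun_def prod_up by (simp add: sum_distrib_left mult.left_commute)
    also have "\<dots> = (\<Sum>e\<in>exps r d. ?c (?up e) * (\<Prod>k<r. of_int (x k) ^ ?up e k))"
      by simp
    also have "\<dots> = (\<Sum>e\<in>?up ` exps r d. ?c e * (\<Prod>k<r. of_int (x k) ^ e k))"
      by (subst sum.reindex[OF inj]) (simp add: o_def)
    also have "\<dots> = mpoly_fun r (Suc d) ?c x"
      unfolding mpoly_fun_def
      by (rule sum.mono_neutral_left[OF finite_exps up_sub]) (use rest in simp)
    finally show ?thesis .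
  qed
  then show ?thesis unfolding is_mpoly_fun_def by blast
qed

lemma is_mpoly_fun_sum:
  assumes "finite A" "\<And>i. i \<in> A \<Longrightarrow> is_mpoly_fun r d (G i)"
  shows "is_mpoly_fun r d (\<lambda>x. \<Sum>i\<in>A. G i x)"
  using assms
proof (induction A rule: finite_induct)
  case empty
  show ?case
    unfolding is_mpoly_fun_def mpoly_fun_def by (intro exI[of _ "\<lambda>_. 0"]) simp
next
  case (insert a A)
  then show ?case by (simp add: is_mpoly_fun_add)
qed

text \<open>Expanding one affine factor gives multiples of the previous power by single variables,
  plus that power itself, so each factor raises the degree bound by one.\<close>

lemma is_mpoly_fun_linear_power:
  "is_mpoly_fun r d (\<lambda>x. (q * (\<Sum>i<r. of_int (x i)) + 1) ^ d)"
proof (induction d)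
  case 0
  show ?case using is_mpoly_fun_const[of r 1] by simp
next
  case (Suc d)
  let ?F = "\<lambda>x :: nat \<Rightarrow> int. (q * (\<Sum>i<r. of_int (x i)) + 1) ^ d"
  have "is_mpoly_fun r (Suc d) (\<lambda>x. \<Sum>i<r. of_int (x i) * ?F x)"
    by (intro is_mpoly_fun_sum is_mpoly_fun_mult_var Suc) auto
  then have "is_mpoly_fun r (Suc d) (\<lambda>x. q * (\<Sum>i<r. of_int (x i) * ?F x) + ?F x)"
    by (intro is_mpoly_fun_add is_mpoly_fun_smult is_mpoly_fun_Suc[OF Suc])
  moreover have "(\<lambda>x. q * (\<Sum>i<r. of_int (x i) * ?F x) + ?F x) =
      (\<lambda>x. (q * (\<Sum>i<r. of_int (x i)) + 1) ^ Suc d)"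
    by (simp add: fun_eq_iff distrib_right sum_distrib_right mult.assoc)
  ultimately show ?case by simp
qed

theorem theorem5p1:
  fixes R :: "('a, 'b) ring_scheme" and I :: "nat \<Rightarrow> 'a set" and r d :: nat
  assumes "noetherian_ring R" and "local_ring R"
    and "krull_dim R = enat d"
    and "\<forall>i<r. ideal (I i) R"
  shows "\<exists>F. numerical_poly r d F \<and>
           (\<exists>N. \<forall>n :: nat \<Rightarrow> nat. (\<forall>i<r. N \<le> n i) \<longrightarrow>
              (\<exists>l::nat. module_length R (H0_quot R (max_ideal R) (ideal_multi_pow R I n r)) = enat l
                 \<and> of_nat l \<le> F (\<lambda>i. int (n i))))"
proof -
  have ex1: "\<exists>!m. maximalideal m R" and cr: "cring R"
    using assms(2) unfolding local_ring_def by auto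
  have mx: "maximalideal (max_ideal R) R"
    unfolding max_ideal_def using ex1 by (rule theI')
  interpret noetherian_local_ring R "max_ideal R"
    using cr assms(1) mx ex1
    by (intro noetherian_local_ring.intro noetherian_cring.intro noetherian_local_ring_axioms.intro) auto
  obtain l where l: "\<And>k. k > 0 \<Longrightarrow> \<exists>Q. ideal Q R \<and> Q \<subseteq> ideal_pow R (max_ideal R) k \<and>
      length_le Q (carrier R) (l * k ^ d)"
    using exists_small_colength[OF assms(3)] by blast
  obtain c where c: "\<And>n. saturation (max_ideal R) (ideal_multi_pow R I n r) \<inter>
      ideal_pow R (max_ideal R) (c * (\<Sum>i<r. n i)) \<subseteq> ideal_multi_pow R I n r"
    using saturation_inter_power_subset[of r I "max_ideal R"] assms(4) max_ideal_ideal by blast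
  \<comment> \<open>The colength bound \<open>l * k ^ d\<close> with \<open>k\<close> replaced by an
    affine form. Its constants \<open>l\<close> and \<open>c\<close> are natural numbers, so it
    takes integer values at all integer points.\<close>
  define F :: "(nat \<Rightarrow> int) \<Rightarrow> rat" where
    "F x = of_nat l * (of_nat c * (\<Sum>i<r. of_int (x i)) + 1) ^ d" for x
  have "is_mpoly_fun r d F"
    unfolding F_def[abs_def] by (intro is_mpoly_fun_smult is_mpoly_fun_linear_power)
  moreover have "F x \<in> \<int>" for x
    unfolding F_def by (intro Ints_mult Ints_power Ints_add Ints_sum) auto
  ultimately have "numerical_poly r d F"
    unfolding numerical_poly_def is_mpoly_fun_def by (auto simp: fun_eq_iff)
  moreover have "\<exists>k::nat. module_length R (H0_quot R (max_ideal R) (ideal_multi_pow R I n r)) = enat k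
      \<and> of_nat k \<le> F (\<lambda>i. int (n i))" for n
  proof -
    \<comment> \<open>The summand 1 makes \<open>?k\<close> positive, as the choice of
      \<open>Q\<close> demands, even when the sum is zero; enlarging the exponent only shrinks the
      power of the maximal ideal.\<close>
    let ?k = "c * (\<Sum>i<r. n i) + 1"
    obtain Q where Q: "ideal Q R" "Q \<subseteq> ideal_pow R (max_ideal R) ?k"
        "length_le Q (carrier R) (l * ?k ^ d)"
      using l[of ?k] by auto
    have "saturation (max_ideal R) (ideal_multi_pow R I n r) \<inter> Q \<subseteq> ideal_multi_pow R I n r"
      using Q(2) c[of n] ideal_pow_antimono[OF max_ideal_ideal, of "c * (\<Sum>i<r. n i)" ?k] by auto
    then obtain k where k: "module_length R (H0_quot R (max_ideal R) (ideal_multi_pow R I n r)) = enat k"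
        "k \<le> l * ?k ^ d"
      using module_length_H0_quot_le[OF multi_pow_ideal max_ideal_ideal Q(1,3)] assms(4) by blast
    have "(of_nat k :: rat) \<le> of_nat (l * ?k ^ d)"
      using k(2) by (simp only: of_nat_le_iff)
    also have "\<dots> = F (\<lambda>i. int (n i))"
      unfolding F_def by (simp add: add.commute)
    finally show ?thesis using k(1) by blast
  qed
  ultimately show ?thesis by blast
qed

end
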